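(* Let $F$ be Thompson's group and let $n\ge 1$ be an integer. The subgroup of $F$ generated by the elements $$x_0x_1^{-1},\ x_2x_3^{-1},\ \ldots,\ x_{2n-2}x_{2n-1}^{-1},\ x_{2n},\ x_{2n+1}$$ is isomorphic to $F\times\mathbb{Z}^n$ and is quasi-isometrically embedded in $F$.
   Context: Thompson's group $F$ is the group with presentation $\langle x_k,\ k\ge 0 \mid x_i^{-1}x_jx_i=x_{j+1}\text{ if } i<j\rangle$. It is generated by $x_0$ and $x_1$, and is given the word metric with respect to $\{x_0,x_1\}$. A map $\Psi:X\to Y$ between metric spaces is a quasi-isometric embedding if there exist constants $K,C>0$ such that $\frac{d(x,x')}{K}-C\le d(\Psi(x),\Psi(x'))\le K\,d(x,x')+C$ for all $x,x'\in X$. A finitely generated subgroup $H$ of a finitely generated group $G$ is quasi-isometrically embedded if the inclusion $H\hookrightarrow G$ is a quasi-isometric embedding, where $H$ and $G$ each carry the word metric of a finite generating set of their own. *)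

theory Defs
  imports "HOL-Algebra.Product_Groups" "HOL-Analysis.Abstract_Metric_Spaces"
begin

section \<open>Groups given by generators and relations\<close>

text \<open>A letter \<open>(x, True)\<close> stands for the generator \<open>x\<close> and \<open>(x, False)\<close> for its formal inverse.
  A pair \<open>(r, s)\<close> of words stands for the relation \<open>r = s\<close>.\<close>

type_synonym 'a gword = "('a \<times> bool) list"

inductive pres_eq :: "('a gword \<times> 'a gword) set \<Rightarrow> 'a gword \<Rightarrow> 'a gword \<Rightarrow> bool" for R where
  pres_refl: "pres_eq R u u"
| pres_sym: "pres_eq R u v \<Longrightarrow> pres_eq R v u"
| pres_trans: "pres_eq R u v \<Longrightarrow> pres_eq R v w \<Longrightarrow> pres_eq R u w"
| pres_cancel: "pres_eq R (u @ [(x, b), (x, \<not> b)] @ v) (u @ v)"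
| pres_rel: "(r, s) \<in> R \<Longrightarrow> pres_eq R (u @ r @ v) (u @ s @ v)"

definition pres_class :: "('a gword \<times> 'a gword) set \<Rightarrow> 'a gword \<Rightarrow> 'a gword set" where
  "pres_class R u = {v. pres_eq R u v}"

definition presented_group :: "('a gword \<times> 'a gword) set \<Rightarrow> 'a gword set monoid" where
  "presented_group R =
     \<lparr>carrier = range (pres_class R),
      monoid.mult = (\<lambda>A B. \<Union>u\<in>A. \<Union>v\<in>B. pres_class R (u @ v)),
      one = pres_class R []\<rparr>"

lemma pres_class_eq_iff: "pres_class R u = pres_class R v \<longleftrightarrow> pres_eq R u v"
  unfolding pres_class_def by (blast intro: pres_refl pres_sym pres_trans)

lemma pres_eq_append_context: "pres_eq R u v \<Longrightarrow> pres_eq R (p @ u @ q) (p @ v @ q)"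
proof (induction rule: pres_eq.induct)
  case (pres_cancel u x b v)
  show ?case using pres_eq.pres_cancel[of R "p @ u" x b "v @ q"] by simp
next
  case (pres_rel r s u v)
  then show ?case using pres_eq.pres_rel[of r s R "p @ u" "v @ q"] by simp
qed (blast intro: pres_refl pres_sym pres_trans)+

lemma pres_eq_append:
  assumes "pres_eq R u u'" "pres_eq R v v'"
  shows "pres_eq R (u @ v) (u' @ v')"
  using pres_eq_append_context[OF assms(1), of "[]" v]
    pres_eq_append_context[OF assms(2), of u' "[]"]
  by (auto intro: pres_trans)

lemma carrier_presented_group: "carrier (presented_group R) = range (pres_class R)"
  by (simp add: presented_group_def)

lemma one_presented_group: "\<one>\<^bsub>presented_group R\<^esub> = pres_class R []"
  by (simp add: presented_group_def)

lemma mult_presented_group: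
  "pres_class R u \<otimes>\<^bsub>presented_group R\<^esub> pres_class R v = pres_class R (u @ v)"
proof -
  have eq: "pres_class R (u' @ v') = pres_class R (u @ v)"
    if "u' \<in> pres_class R u" "v' \<in> pres_class R v" for u' v'
    using that pres_eq_append[of R u u' v v'] unfolding pres_class_eq_iff
    by (auto simp: pres_class_def intro: pres_sym)
  have "u \<in> pres_class R u" "v \<in> pres_class R v"
    by (auto simp: pres_class_def intro: pres_refl)
  then have "(\<Union>u'\<in>pres_class R u. \<Union>v'\<in>pres_class R v. pres_class R (u @ v)) = pres_class R (u @ v)"
    by blast
  moreover have "(\<Union>u'\<in>pres_class R u. \<Union>v'\<in>pres_class R v. pres_class R (u' @ v')) =
      (\<Union>u'\<in>pres_class R u. \<Union>v'\<in>pres_class R v. pres_class R (u @ v))"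
    by (intro SUP_cong refl eq)
  ultimately show ?thesis
    unfolding presented_group_def by simp
qed

lemma pres_eq_inverse:
  "pres_eq R (map (\<lambda>(x, b). (x, \<not> b)) (rev u) @ u) []"
proof (induction u)
  case Nil
  show ?case by (simp add: pres_refl)
next
  case (Cons a u)
  obtain x b where a: "a = (x, b)" by (cases a)
  have "pres_eq R (map (\<lambda>(x, b). (x, \<not> b)) (rev (a # u)) @ a # u)
      (map (\<lambda>(x, b). (x, \<not> b)) (rev u) @ u)"
    using pres_cancel[of R "map (\<lambda>(x, b). (x, \<not> b)) (rev u)" x "\<not> b" u] by (simp add: a)
  then show ?case using Cons.IH by (rule pres_trans)
qed

lemma group_presented_group: "group (presented_group R)"
proof (rule groupI)
  fix A assume "A \<in> carrier (presented_group R)"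
  then obtain u where u: "A = pres_class R u" by (auto simp: carrier_presented_group)
  let ?B = "pres_class R (map (\<lambda>(x, b). (x, \<not> b)) (rev u))"
  have "?B \<otimes>\<^bsub>presented_group R\<^esub> A = \<one>\<^bsub>presented_group R\<^esub>"
    unfolding u mult_presented_group one_presented_group pres_class_eq_iff by (rule pres_eq_inverse)
  moreover have "?B \<in> carrier (presented_group R)"
    unfolding carrier_presented_group by (rule rangeI)
  ultimately show
    "\<exists>B\<in>carrier (presented_group R). B \<otimes>\<^bsub>presented_group R\<^esub> A = \<one>\<^bsub>presented_group R\<^esub>"
    by (rule bexI)
  show "\<one>\<^bsub>presented_group R\<^esub> \<otimes>\<^bsub>presented_group R\<^esub> A = A"
    unfolding u one_presented_group mult_presented_group by simp
next
  fix A B assume "A \<in> carrier (presented_group R)" "B \<in> carrier (presented_group R)"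
  then obtain u v where uv: "A = pres_class R u" "B = pres_class R v"
    unfolding carrier_presented_group by blast
  show "A \<otimes>\<^bsub>presented_group R\<^esub> B \<in> carrier (presented_group R)"
    unfolding uv mult_presented_group carrier_presented_group by (rule rangeI)
  fix C assume "C \<in> carrier (presented_group R)"
  then obtain w where w: "C = pres_class R w"
    unfolding carrier_presented_group by blast
  show "A \<otimes>\<^bsub>presented_group R\<^esub> B \<otimes>\<^bsub>presented_group R\<^esub> C =
      A \<otimes>\<^bsub>presented_group R\<^esub> (B \<otimes>\<^bsub>presented_group R\<^esub> C)"
    unfolding uv w mult_presented_group by simp
next
  show "\<one>\<^bsub>presented_group R\<^esub> \<in> carrier (presented_group R)"
    unfolding one_presented_group carrier_presented_group by (rule rangeI)
qed

section \<open>Thompson's group F\<close>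

definition thompson_rels :: "(nat gword \<times> nat gword) set" where
  "thompson_rels =
     {([(i, False), (j, True), (i, True)], [(Suc j, True)]) | i j. i < j}"

definition thompson_F :: "nat gword set monoid" where
  "thompson_F = presented_group thompson_rels"

definition thompson_x :: "nat \<Rightarrow> nat gword set" where
  "thompson_x k = pres_class thompson_rels [(k, True)]"

lemma group_thompson_F: "group thompson_F"
  by (simp add: thompson_F_def group_presented_group)

lemma thompson_x_closed: "thompson_x k \<in> carrier thompson_F"
  unfolding thompson_x_def thompson_F_def carrier_presented_group by (rule rangeI)

lemma inv_thompson_x: "inv\<^bsub>thompson_F\<^esub> thompson_x k = pres_class thompson_rels [(k, False)]"
proof (rule group.inv_equality[OF group_thompson_F])
  show "pres_class thompson_rels [(k, False)] \<otimes>\<^bsub>thompson_F\<^esub> thompson_x k = \<one>\<^bsub>thompson_F\<^esub>"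
    unfolding thompson_x_def thompson_F_def mult_presented_group one_presented_group
      pres_class_eq_iff
    using pres_cancel[of thompson_rels "[]" k False "[]"] by simp
  show "pres_class thompson_rels [(k, False)] \<in> carrier thompson_F"
    unfolding thompson_F_def carrier_presented_group by (rule rangeI)
qed (rule thompson_x_closed)

lemma thompson_x_conj:
  assumes "i < j"
  shows "inv\<^bsub>thompson_F\<^esub> thompson_x i \<otimes>\<^bsub>thompson_F\<^esub> thompson_x j \<otimes>\<^bsub>thompson_F\<^esub> thompson_x i
    = thompson_x (Suc j)"
proof -
  have "([(i, False), (j, True), (i, True)], [(Suc j, True)]) \<in> thompson_rels"
    using assms unfolding thompson_rels_def by blast
  then have "pres_eq thompson_rels [(i, False), (j, True), (i, True)] [(Suc j, True)]"
    using pres_rel[of _ _ thompson_rels "[]" "[]"] by fastforce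
  then show ?thesis
    unfolding inv_thompson_x unfolding thompson_x_def thompson_F_def mult_presented_group
      pres_class_eq_iff by simp
qed

section \<open>Word metrics\<close>

definition word_length :: "('a, 'b) monoid_scheme \<Rightarrow> 'a set \<Rightarrow> 'a \<Rightarrow> nat" where
  "word_length G S g =
     (LEAST k. \<exists>w. length w = k \<and> set w \<subseteq> S \<union> m_inv G ` S \<and> foldr (mult G) w \<one>\<^bsub>G\<^esub> = g)"

text \<open>The value 0 outside the carrier is needed because \<^const>\<open>Metric_space\<close> requires
  symmetry and nonnegativity on the whole type. The metric is meaningful only if \<open>S\<close>
  generates \<open>G\<close>.\<close>

definition word_dist :: "('a, 'b) monoid_scheme \<Rightarrow> 'a set \<Rightarrow> 'a \<Rightarrow> 'a \<Rightarrow> real" where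
  "word_dist G S g h =
     (if g \<in> carrier G \<and> h \<in> carrier G then real (word_length G S (inv\<^bsub>G\<^esub> g \<otimes>\<^bsub>G\<^esub> h)) else 0)"

definition word_metric :: "('a, 'b) monoid_scheme \<Rightarrow> 'a set \<Rightarrow> 'a metric" where
  "word_metric G S = metric (carrier G, word_dist G S)"

definition finite_generating_set :: "('a, 'b) monoid_scheme \<Rightarrow> 'a set \<Rightarrow> bool" where
  "finite_generating_set G S \<longleftrightarrow> finite S \<and> S \<subseteq> carrier G \<and> generate G S = carrier G"

context group
begin

lemma foldr_mult_closed: "set w \<subseteq> carrier G \<Longrightarrow> foldr (\<otimes>) w \<one> \<in> carrier G"
  by (induction w) auto

lemma foldr_mult_append:
  "set u \<subseteq> carrier G \<Longrightarrow> set v \<subseteq> carrier G \<Longrightarrow>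
     foldr (\<otimes>) (u @ v) \<one> = foldr (\<otimes>) u \<one> \<otimes> foldr (\<otimes>) v \<one>"
proof (induction u)
  case (Cons a u)
  then have "foldr (\<otimes>) (u @ v) \<one> = foldr (\<otimes>) u \<one> \<otimes> foldr (\<otimes>) v \<one>" by simp
  then have "foldr (\<otimes>) ((a # u) @ v) \<one> = a \<otimes> (foldr (\<otimes>) u \<one> \<otimes> foldr (\<otimes>) v \<one>)"
    by simp
  with Cons.prems show ?case by (simp add: foldr_mult_closed m_assoc del: foldr_append)
qed (simp add: foldr_mult_closed)

lemma foldr_mult_rev_inv:
  "set w \<subseteq> carrier G \<Longrightarrow> foldr (\<otimes>) (rev (map (m_inv G) w)) \<one> = inv (foldr (\<otimes>) w \<one>)"
proof (induction w)
  case (Cons a w)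
  then have "set (rev (map (m_inv G) w)) \<subseteq> carrier G" by auto
  with Cons show ?case
    using foldr_mult_append[of "rev (map (m_inv G) w)" "[inv a]"]
    by (simp add: inv_mult_group foldr_mult_closed)
qed simp

lemma ex_word:
  assumes "S \<subseteq> carrier G" "g \<in> generate G S"
  shows "\<exists>w. set w \<subseteq> S \<union> m_inv G ` S \<and> foldr (\<otimes>) w \<one> = g"
  using assms(2)
proof induction
  case one
  show ?case by (rule exI[of _ "[]"]) simp
next
  case (incl h)
  then show ?case using assms(1) by (intro exI[of _ "[h]"]) auto
next
  case (inv h)
  then show ?case using assms(1) by (intro exI[of _ "[inv h]"]) auto
next
  case (eng h1 h2)
  then obtain u v where u: "set u \<subseteq> S \<union> m_inv G ` S" "foldr (\<otimes>) u \<one> = h1"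
    and v: "set v \<subseteq> S \<union> m_inv G ` S" "foldr (\<otimes>) v \<one> = h2" by blast
  have "S \<union> m_inv G ` S \<subseteq> carrier G" using assms(1) by auto
  with u(1) v(1) have "set u \<subseteq> carrier G" "set v \<subseteq> carrier G" by blast+
  from foldr_mult_append[OF this] have "foldr (\<otimes>) (u @ v) \<one> = h1 \<otimes> h2"
    by (simp only: u(2) v(2))
  moreover have "set (u @ v) \<subseteq> S \<union> m_inv G ` S" using u(1) v(1) by simp
  ultimately show ?case by blast
qed

lemma word_length_le:
  "set w \<subseteq> S \<union> m_inv G ` S \<Longrightarrow> word_length G S (foldr (\<otimes>) w \<one>) \<le> length w"
  unfolding word_length_def by (rule Least_le) blast

lemma word_length_attained:
  assumes "S \<subseteq> carrier G" "g \<in> generate G S"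
  obtains w where "length w = word_length G S g" "set w \<subseteq> S \<union> m_inv G ` S"
    "foldr (\<otimes>) w \<one> = g"
proof -
  have "\<exists>k w. length w = k \<and> set w \<subseteq> S \<union> m_inv G ` S \<and> foldr (\<otimes>) w \<one> = g"
    using ex_word[OF assms] by blast
  from LeastI_ex[OF this] show thesis
    unfolding word_length_def[symmetric] using that by blast
qed

lemma word_length_mult_le:
  assumes "S \<subseteq> carrier G" "g \<in> generate G S" "h \<in> generate G S"
  shows "word_length G S (g \<otimes> h) \<le> word_length G S g + word_length G S h"
proof -
  obtain u where u: "length u = word_length G S g" "set u \<subseteq> S \<union> m_inv G ` S"
    "foldr (\<otimes>) u \<one> = g"
    using word_length_attained[OF assms(1,2)] .
  obtain v where v: "length v = word_length G S h" "set v \<subseteq> S \<union> m_inv G ` S"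
    "foldr (\<otimes>) v \<one> = h"
    using word_length_attained[OF assms(1,3)] .
  have "S \<union> m_inv G ` S \<subseteq> carrier G" using assms(1) by auto
  with u(2) v(2) have "set u \<subseteq> carrier G" "set v \<subseteq> carrier G" by blast+
  from foldr_mult_append[OF this] have "foldr (\<otimes>) (u @ v) \<one> = g \<otimes> h"
    by (simp only: u(3) v(3))
  moreover have "set (u @ v) \<subseteq> S \<union> m_inv G ` S" using u(2) v(2) by simp
  ultimately have "word_length G S (g \<otimes> h) \<le> length (u @ v)"
    using word_length_le by metis
  then show ?thesis by (simp add: u(1) v(1))
qed

lemma word_length_inv_le:
  assumes "S \<subseteq> carrier G" "g \<in> generate G S"
  shows "word_length G S (inv g) \<le> word_length G S g"
proof -
  obtain u where u: "length u = word_length G S g" "set u \<subseteq> S \<union> m_inv G ` S"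
    "foldr (\<otimes>) u \<one> = g"
    using word_length_attained[OF assms(1,2)] .
  have "inv x \<in> S \<union> m_inv G ` S" if "x \<in> S \<union> m_inv G ` S" for x
    using that assms(1) by auto
  with u(2) have "set (rev (map (m_inv G) u)) \<subseteq> S \<union> m_inv G ` S" by auto
  moreover have "set u \<subseteq> carrier G" using u(2) assms(1) by auto
  ultimately show ?thesis
    using word_length_le[of "rev (map (m_inv G) u)" S] foldr_mult_rev_inv[of u] u(1,3)
    by (simp del: foldr_map)
qed

lemma word_length_eq_0_iff:
  assumes "S \<subseteq> carrier G" "g \<in> generate G S"
  shows "word_length G S g = 0 \<longleftrightarrow> g = \<one>"
proof
  assume "word_length G S g = 0"
  moreover obtain w where "length w = word_length G S g" "foldr (\<otimes>) w \<one> = g"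
    using word_length_attained[OF assms] .
  ultimately show "g = \<one>" by simp
next
  assume "g = \<one>"
  then show "word_length G S g = 0"
    using word_length_le[of "[]" S] by simp
qed

lemma Metric_space_word_dist:
  assumes "S \<subseteq> carrier G" "generate G S = carrier G"
  shows "Metric_space (carrier G) (word_dist G S)"
proof
  fix g h
  have le: "word_length G S (inv g \<otimes> h) \<le> word_length G S (inv h \<otimes> g)"
    if "g \<in> carrier G" "h \<in> carrier G" for g h
    using word_length_inv_le[OF assms(1), of "inv h \<otimes> g"] that
    by (simp add: assms(2) inv_mult_group)
  show "0 \<le> word_dist G S g h" by (simp add: word_dist_def)
  show "word_dist G S g h = word_dist G S h g"
    using le[of g h] le[of h g] by (auto simp: word_dist_def)
next
  fix g h assume gh: "g \<in> carrier G" "h \<in> carrier G"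
  then have "inv g \<otimes> h = \<one> \<longleftrightarrow> g = h"
    using inv_solve_left'[of \<one> g h] by auto
  with gh show "word_dist G S g h = 0 \<longleftrightarrow> g = h"
    using word_length_eq_0_iff[OF assms(1), of "inv g \<otimes> h"] by (simp add: word_dist_def assms(2))
next
  fix f g h assume fgh: "f \<in> carrier G" "g \<in> carrier G" "h \<in> carrier G"
  then have "inv f \<otimes> h = (inv f \<otimes> g) \<otimes> (inv g \<otimes> h)"
    using m_assoc[of "inv f" g "inv g \<otimes> h"] m_assoc[of g "inv g" h] by simp
  with fgh show "word_dist G S f h \<le> word_dist G S f g + word_dist G S g h"
    using word_length_mult_le[OF assms(1), of "inv f \<otimes> g" "inv g \<otimes> h"]
    by (simp add: word_dist_def assms(2))
qed

lemma
  assumes "finite_generating_set G S"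
  shows mspace_word_metric: "mspace (word_metric G S) = carrier G"
    and mdist_word_metric: "mdist (word_metric G S) = word_dist G S"
proof -
  have M: "Metric_space (carrier G) (word_dist G S)"
    using assms by (intro Metric_space_word_dist) (auto simp: finite_generating_set_def)
  show "mspace (word_metric G S) = carrier G" "mdist (word_metric G S) = word_dist G S"
    unfolding word_metric_def
    by (rule Metric_space.mspace_metric[OF M], rule Metric_space.mdist_metric[OF M])
qed

end

section \<open>Quasi-isometric embeddings\<close>

definition quasi_isometric_embedding :: "'a metric \<Rightarrow> 'b metric \<Rightarrow> ('a \<Rightarrow> 'b) \<Rightarrow> bool" where
  "quasi_isometric_embedding X Y \<Psi> \<longleftrightarrow>
     \<Psi> \<in> mspace X \<rightarrow> mspace Y \<and>
     (\<exists>K>0. \<exists>C>0. \<forall>x\<in>mspace X. \<forall>x'\<in>mspace X.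
        mdist X x x' / K - C \<le> mdist Y (\<Psi> x) (\<Psi> x') \<and>
        mdist Y (\<Psi> x) (\<Psi> x') \<le> K * mdist X x x' + C)"

text \<open>Word metrics of different finite generating sets of a group are bi-Lipschitz equivalent, so
  the choice of generating sets is immaterial. The definition quantifies over all choices, and the
  finite generation of both groups is demanded separately so that it is never vacuous.\<close>

definition quasi_isometrically_embedded ::
    "'a set \<Rightarrow> ('a, 'b) monoid_scheme \<Rightarrow> bool" where
  "quasi_isometrically_embedded H G \<longleftrightarrow>
     subgroup H G \<and>
     (\<exists>S. finite_generating_set G S) \<and>
     (\<exists>T. finite_generating_set (G\<lparr>carrier := H\<rparr>) T) \<and>
     (\<forall>S T. finite_generating_set G S \<longrightarrow> finite_generating_set (G\<lparr>carrier := H\<rparr>) T \<longrightarrow>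
        quasi_isometric_embedding (word_metric (G\<lparr>carrier := H\<rparr>) T) (word_metric G S) (\<lambda>h. h))"

end

theory Submission
  imports Defs "HOL-Library.Stream"
begin

text \<open>Write \<open>y\<^sub>i = x\<^sub>2\<^sub>i x\<^sub>2\<^sub>i\<^sub>+\<^sub>1\<^sup>-\<^sup>1\<close> for \<open>i < n\<close>. The relations of F show at once that the
  \<open>y\<^sub>i\<close> commute with each other and with all \<open>x\<^sub>k\<close> for \<open>k \<ge> 2n\<close>, and that \<open>x\<^sub>k \<mapsto> x\<^sub>k\<^sub>+\<^sub>2\<^sub>n\<close> defines an
  endomorphism \<open>\<phi>\<close> of F. So sending \<open>(g, a)\<close> to the product of \<open>\<phi>(g)\<close> and the powers of the \<open>y\<^sub>i\<close> with exponents \<open>a\<^sub>i\<close> is a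
  homomorphism from \<open>F \<times> \<int>\<^sup>n\<close> onto the subgroup. That it is injective and that its image is undistorted both follow from a lower
  bound on word length in F, obtained from an action.

  F acts on the ends of a row of infinite binary trees: \<open>x\<^sub>i\<close> joins the trees \<open>i\<close> and \<open>i + 1\<close> under a new
  root. Call a cone below a node, or a tail of the row, bad for an element if the element does not carry it rigidly
  onto another cone or tail. Let the complexity of \<open>g\<close> be the number of bad cells of \<open>g\<close> and of its inverse.
  Three facts about complexity suffice.

  \<^item> It is subadditive, hence at most a constant times the word length
    (\<open>complexity_mult_le\<close>, \<open>subadditive_le_word_length\<close>).

  \<^item> The word length of \<open>g\<close> is at most five times its complexity (\<open>F_length_le_complexity\<close>). Write \<open>g\<close> as
    a fraction \<open>P Q\<^sup>-\<^sup>1\<close> of positive words of minimal length and read \<open>P\<close> and \<open>Q\<close> as forests. An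
    interior node of \<open>Q\<close> on which \<open>g\<close> is not bad would lead to a common exposed caret of \<open>P\<close> and \<open>Q\<close>, which
    could be cancelled. So the number of carets and the positions of the nontrivial trees are bounded
    by the complexity, and a sorted positive word is spelled economically in \<open>x\<^sub>0\<close> and \<open>x\<^sub>1\<close>.

  \<^item> The complexity of the image of \<open>(g, a)\<close> is at least that of \<open>g\<close> and at least each \<open>\<bar>a\<^sub>i\<bar>\<close>, since the factors act
    on disjoint sets of trees (\<open>complexity_prod_map\<close>).

  If the image of \<open>(g, a)\<close> is trivial, its complexity is zero, so \<open>a = 0\<close> and \<open>g\<close> has word length zero. In general, the length of
  the image inside the subgroup is at most linear in the word length of \<open>g\<close> and the \<open>\<bar>a\<^sub>i\<bar>\<close>, hence linear
  in its complexity, hence linear in its word length in F.\<close>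

section \<open>Subadditive functions and word length\<close>

text \<open>A function that is subadditive on products grows by a bounded amount with each letter of a word. All
  Lipschitz estimates below are instances: comparison of two finite generating sets, the inclusion of
  a subgroup, the shift endomorphism, and the complexity of an element of F.\<close>

lemma (in group) subadditive_le_word_length:
  fixes L :: "'a \<Rightarrow> nat"
  assumes S: "finite_generating_set G S"
    and L1: "L \<one> = 0"
    and Lm: "\<And>g h. g \<in> carrier G \<Longrightarrow> h \<in> carrier G \<Longrightarrow> L (g \<otimes> h) \<le> L g + L h"
  shows "\<exists>K. \<forall>g\<in>carrier G. L g \<le> K * word_length G S g"
proof -
  let ?A = "S \<union> m_inv G ` S"
  have fin: "finite ?A" and sub: "S \<subseteq> carrier G" and A: "?A \<subseteq> carrier G"
    and gen: "generate G S = carrier G"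
    using S by (auto simp: finite_generating_set_def)
  define K where "K = Max (insert 0 (L ` ?A))"
  have K: "L a \<le> K" if "a \<in> ?A" for a
    unfolding K_def using fin that by (intro Max_ge) auto
  have word: "L (foldr (\<otimes>) w \<one>) \<le> K * length w" if "set w \<subseteq> ?A" for w
    using that
  proof (induction w)
    case (Cons a w)
    have "set w \<subseteq> carrier G" "a \<in> carrier G" using Cons.prems A by auto
    then have "L (foldr (\<otimes>) (a # w) \<one>) \<le> L a + L (foldr (\<otimes>) w \<one>)"
      using Lm[OF _ foldr_mult_closed] by simp
    also have "\<dots> \<le> K + K * length w"
      using Cons K[of a] by (intro add_mono) auto
    finally show ?case by simp
  qed (simp add: L1)
  show ?thesis
  proof (intro exI ballI)
    fix g assume "g \<in> carrier G"
    then obtain w where "length w = word_length G S g" "set w \<subseteq> ?A" "foldr (\<otimes>) w \<one> = g"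
      using word_length_attained[OF sub] gen by metis
    then show "L g \<le> K * word_length G S g" using word by metis
  qed
qed

lemma (in group) word_length_one: "word_length G S \<one> = 0"
  using word_length_le[of "[]" S] by simp

lemma (in group) word_length_generator: "s \<in> S \<Longrightarrow> s \<in> carrier G \<Longrightarrow> word_length G S s \<le> 1"
  using word_length_le[of "[s]" S] by simp

lemma (in group) word_length_mult_le':
  assumes "finite_generating_set G S" "g \<in> carrier G" "h \<in> carrier G"
  shows "word_length G S (g \<otimes> h) \<le> word_length G S g + word_length G S h"
  using word_length_mult_le[of S g h] assms by (simp add: finite_generating_set_def)

lemma (in group) word_length_inv_le':
  assumes "finite_generating_set G S" "g \<in> carrier G"
  shows "word_length G S (inv g) \<le> word_length G S g"
  using word_length_inv_le[of S g] assms by (simp add: finite_generating_set_def)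

lemma (in group) word_length_nat_pow_le:
  assumes S: "finite_generating_set G S" and g: "g \<in> carrier G"
  shows "word_length G S (g [^] (k::nat)) \<le> k * word_length G S g"
proof (induction k)
  case (Suc k)
  have "word_length G S (g [^] Suc k) \<le> word_length G S (g [^] k) + word_length G S g"
    unfolding nat_pow_Suc by (rule word_length_mult_le'[OF S]) (use g in auto)
  with Suc.IH show ?case unfolding mult_Suc by linarith
qed (simp add: word_length_one)

lemma (in group) word_length_int_pow_le:
  assumes S: "finite_generating_set G S" and g: "g \<in> carrier G"
  shows "word_length G S (g [^] (k::int)) \<le> nat \<bar>k\<bar> * word_length G S g"
proof (cases k rule: int_cases2)
  case (nonneg m)
  show ?thesis
    unfolding nonneg int_pow_int using word_length_nat_pow_le[OF S g, of m] by simp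
next
  case (nonpos m)
  have "g [^] k = inv (g [^] m)"
    unfolding nonpos using g by (rule int_pow_neg_int)
  moreover have "word_length G S (inv (g [^] m)) \<le> word_length G S (g [^] m)"
    by (rule word_length_inv_le'[OF S]) (rule nat_pow_closed[OF g])
  moreover have "word_length G S (g [^] m) \<le> m * word_length G S g"
    by (rule word_length_nat_pow_le[OF S g])
  ultimately show ?thesis unfolding nonpos by simp
qed

text \<open>The inclusion of a finitely generated subgroup is always Lipschitz, so only the lower estimate,
  which says that the subgroup is undistorted, is left as a condition.\<close>

lemma (in group) quasi_isometrically_embeddedI:
  assumes H: "subgroup H G"
    and S0: "finite_generating_set G S0"
    and T0: "finite_generating_set (G\<lparr>carrier := H\<rparr>) T0"
    and lower: "\<And>S T. finite_generating_set G S \<Longrightarrow> finite_generating_set (G\<lparr>carrier := H\<rparr>) T \<Longrightarrow>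
      \<exists>K. \<forall>h\<in>H. word_length (G\<lparr>carrier := H\<rparr>) T h \<le> K * word_length G S h"
  shows "quasi_isometrically_embedded H G"
proof -
  have "quasi_isometric_embedding (word_metric (G\<lparr>carrier := H\<rparr>) T) (word_metric G S) (\<lambda>h. h)"
    if S: "finite_generating_set G S" and T: "finite_generating_set (G\<lparr>carrier := H\<rparr>) T" for S T
  proof -
    interpret H: group "G\<lparr>carrier := H\<rparr>"
      using H subgroup.subgroup_is_group by blast
    have HG: "H \<subseteq> carrier G" using H by (rule subgroup.subset)
    obtain K1 where K1: "\<And>h. h \<in> H \<Longrightarrow> word_length (G\<lparr>carrier := H\<rparr>) T h \<le> K1 * word_length G S h"
      using lower[OF S T] by blast
    obtain K2 where K2: "\<And>h. h \<in> H \<Longrightarrow> word_length G S h \<le> K2 * word_length (G\<lparr>carrier := H\<rparr>) T h"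
    proof -
      have "word_length G S (g \<otimes> h) \<le> word_length G S g + word_length G S h"
        if "g \<in> H" "h \<in> H" for g h
        using word_length_mult_le'[OF S] HG that by blast
      then have "\<exists>K. \<forall>h\<in>H. word_length G S h \<le> K * word_length (G\<lparr>carrier := H\<rparr>) T h"
        using H.subadditive_le_word_length[OF T, of "word_length G S"] word_length_one by simp
      then show thesis using that by blast
    qed
    define K where "K = real (K1 + K2 + 1)"
    have K: "K > 0" "real K1 \<le> K" "real K2 \<le> K" by (simp_all add: K_def)
    have dist: "mdist (word_metric (G\<lparr>carrier := H\<rparr>) T) g h / K - 1 \<le> mdist (word_metric G S) g h \<and>
        mdist (word_metric G S) g h \<le> K * mdist (word_metric (G\<lparr>carrier := H\<rparr>) T) g h + 1"
      if gh: "g \<in> H" "h \<in> H" for g h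
    proof -
      let ?d = "inv g \<otimes> h"
      let ?lH = "real (word_length (G\<lparr>carrier := H\<rparr>) T ?d)" and ?lG = "real (word_length G S ?d)"
      have d: "?d \<in> H" using gh H by (simp add: subgroup.m_closed subgroup.m_inv_closed)
      have dH: "mdist (word_metric (G\<lparr>carrier := H\<rparr>) T) g h = ?lH"
        using gh m_inv_consistent[OF H] by (simp add: H.mdist_word_metric[OF T] word_dist_def)
      have dG: "mdist (word_metric G S) g h = ?lG"
        using gh HG by (auto simp: mdist_word_metric[OF S] word_dist_def)
      have "?lH \<le> real (K1 * word_length G S ?d)" using K1[OF d] by (simp only: of_nat_le_iff)
      also have "\<dots> \<le> K * ?lG" using K by (simp add: mult_right_mono)
      finally have 1: "?lH / K \<le> ?lG" using K by (simp add: field_simps)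
      have "?lG \<le> real (K2 * word_length (G\<lparr>carrier := H\<rparr>) T ?d)"
        using K2[OF d] by (simp only: of_nat_le_iff)
      also have "\<dots> \<le> K * ?lH" using K by (simp add: mult_right_mono)
      finally have 2: "?lG \<le> K * ?lH" .
      show ?thesis using 1 2 unfolding dH dG by linarith
    qed
    show ?thesis
      unfolding quasi_isometric_embedding_def
    proof (rule conjI[OF _ exI[of _ K, OF conjI[OF _ exI[of _ "1::real"]]]])
      show "(\<lambda>h. h) \<in> mspace (word_metric (G\<lparr>carrier := H\<rparr>) T) \<rightarrow> mspace (word_metric G S)"
        using HG by (auto simp: mspace_word_metric[OF S] H.mspace_word_metric[OF T])
    qed (use K dist in \<open>auto simp: H.mspace_word_metric[OF T]\<close>)
  qed
  then show ?thesis
    unfolding quasi_isometrically_embedded_def using H S0 T0 by blast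
qed

section \<open>Functions on a presented group\<close>

text \<open>A function on words that respects the relations descends to the classes. This serves both for
  the action of F on points and for its endomorphisms.\<close>

definition presented_lift :: "('a gword \<times> 'a gword) set \<Rightarrow> ('a gword \<Rightarrow> 'b) \<Rightarrow> 'a gword set \<Rightarrow> 'b" where
  "presented_lift R f A = f (SOME u. pres_class R u = A)"

lemma presented_lift_class:
  assumes "\<And>u v. pres_eq R u v \<Longrightarrow> f u = f v"
  shows "presented_lift R f (pres_class R u) = f u"
proof -
  have "pres_class R (SOME v. pres_class R v = pres_class R u) = pres_class R u"
    by (rule someI) (rule refl)
  then show ?thesis
    unfolding presented_lift_def pres_class_eq_iff by (rule assms)
qed

interpretation F: group thompson_F
  by (rule group_thompson_F)

lemma thompson_F_classE:
  assumes "g \<in> carrier thompson_F"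
  obtains u where "g = pres_class thompson_rels u"
  using assms unfolding thompson_F_def carrier_presented_group by blast

lemma thompson_F_class_closed: "pres_class thompson_rels u \<in> carrier thompson_F"
  unfolding thompson_F_def carrier_presented_group by blast

lemma thompson_F_mult_class:
  "pres_class thompson_rels u \<otimes>\<^bsub>thompson_F\<^esub> pres_class thompson_rels v = pres_class thompson_rels (u @ v)"
  unfolding thompson_F_def by (rule mult_presented_group)

lemma thompson_F_one_class: "\<one>\<^bsub>thompson_F\<^esub> = pres_class thompson_rels []"
  unfolding thompson_F_def by (rule one_presented_group)

section \<open>The action of F on ends of an infinite binary forest\<close>

text \<open>A point \<open>(j, z)\<close> is the end of the \<open>j\<close>-th tree in a row of infinite complete binary trees that
  is reached by following the branches \<open>z\<close>. The function \<open>graft i\<close> makes the trees \<open>i\<close> and \<open>i + 1\<close> the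
  two subtrees of one new root and renumbers the trees to their right; \<open>prune i\<close> undoes this.\<close>

type_synonym point = "nat \<times> bool stream"

definition graft :: "nat \<Rightarrow> point \<Rightarrow> point" where
  "graft i = (\<lambda>(j, z). if j < i then (j, z) else if j = i then (i, False ## z)
     else if j = Suc i then (i, True ## z) else (j - 1, z))"

definition prune :: "nat \<Rightarrow> point \<Rightarrow> point" where
  "prune i = (\<lambda>(j, z). if j < i then (j, z)
     else if j = i then (if shd z then Suc i else i, stl z) else (Suc j, z))"

lemma prune_graft: "prune i \<circ> graft i = id"
  by (auto simp: fun_eq_iff prune_def graft_def)

lemma graft_prune: "graft i \<circ> prune i = id"
proof
  fix p :: point
  obtain j b z where p: "p = (j, b ## z)" by (metis surj_pair stream.exhaust)
  show "(graft i \<circ> prune i) p = id p" by (cases b) (auto simp: p prune_def graft_def)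
qed

text \<open>The defining relation of F in the form \<open>x\<^sub>j x\<^sub>i = x\<^sub>i x\<^sub>j\<^sub>+\<^sub>1\<close>: after two trees have been
  joined, the trees to their right have moved one place to the left.\<close>

lemma graft_comm: "i < j \<Longrightarrow> graft j \<circ> graft i = graft i \<circ> graft (Suc j)"
  by (auto simp: fun_eq_iff graft_def)

definition letter_act :: "nat \<times> bool \<Rightarrow> point \<Rightarrow> point" where
  "letter_act l = (if snd l then graft (fst l) else prune (fst l))"

definition word_act :: "nat gword \<Rightarrow> point \<Rightarrow> point" where
  "word_act u = foldr (\<lambda>l f. letter_act l \<circ> f) u id"

lemma word_act_Nil [simp]: "word_act [] = id"
  and word_act_Cons: "word_act (l # u) = letter_act l \<circ> word_act u"
  by (simp_all add: word_act_def)

lemma word_act_append: "word_act (u @ v) = word_act u \<circ> word_act v"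
  by (induction u) (simp_all add: word_act_Cons comp_assoc)

lemma word_act_respects: "pres_eq thompson_rels u v \<Longrightarrow> word_act u = word_act v"
proof (induction rule: pres_eq.induct)
  case (pres_cancel u x b v)
  have "word_act [(x, b), (x, \<not> b)] = id"
    by (cases b) (simp_all add: word_act_Cons letter_act_def prune_graft graft_prune)
  then show ?case
    using word_act_append[of "[(x, b), (x, \<not> b)]" v] by (simp add: word_act_append)
next
  case (pres_rel r s u v)
  then obtain i j where ij: "i < j" and rs: "r = [(i, False), (j, True), (i, True)]" "s = [(Suc j, True)]"
    by (auto simp: thompson_rels_def)
  have "word_act r = prune i \<circ> (graft j \<circ> graft i)"
    by (simp add: rs word_act_Cons letter_act_def comp_assoc)
  also have "\<dots> = (prune i \<circ> graft i) \<circ> graft (Suc j)"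
    by (simp add: graft_comm[OF ij] comp_assoc)
  also have "\<dots> = word_act s"
    by (simp add: prune_graft rs word_act_Cons letter_act_def)
  finally show ?case by (simp add: word_act_append)
qed simp_all

definition act :: "nat gword set \<Rightarrow> point \<Rightarrow> point" where
  "act = presented_lift thompson_rels word_act"

lemma act_class: "act (pres_class thompson_rels u) = word_act u"
  unfolding act_def by (rule presented_lift_class[OF word_act_respects])

lemma act_mult:
  assumes "g \<in> carrier thompson_F" "h \<in> carrier thompson_F"
  shows "act (g \<otimes>\<^bsub>thompson_F\<^esub> h) = act g \<circ> act h"
  using assms
  by (elim thompson_F_classE) (simp add: thompson_F_mult_class act_class word_act_append)

lemma act_one: "act \<one>\<^bsub>thompson_F\<^esub> = id"
  by (simp add: thompson_F_one_class act_class)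

lemma act_x: "act (thompson_x i) = graft i"
  by (simp add: thompson_x_def act_class word_act_Cons letter_act_def)

lemma act_inv_x: "act (inv\<^bsub>thompson_F\<^esub> thompson_x i) = prune i"
  by (simp add: inv_thompson_x act_class word_act_Cons letter_act_def)

lemma act_inv_left: "g \<in> carrier thompson_F \<Longrightarrow> act (inv\<^bsub>thompson_F\<^esub> g) (act g p) = p"
  using act_mult[of "inv\<^bsub>thompson_F\<^esub> g" g] F.inv_closed F.l_inv act_one
  by (metis comp_apply id_apply)

lemma inj_act: "g \<in> carrier thompson_F \<Longrightarrow> inj (act g)"
  by (metis act_inv_left injI)

section \<open>Cells, bad cells and complexity\<close>

type_synonym node = "nat \<times> bool list"

text \<open>A cell is a subset of the points that is similar to a standard one: the cone of ends below a
  node, or the tail of all trees from the \<open>J\<close>-th one on. The map \<open>cell_map c\<close> parametrises the cell; for a cone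
  it forgets the first coordinate, so that no cone is matched with a tail. A map is good on a cell if it
  carries the parametrisation to that of another cell, and \<open>bad f\<close> collects all other cells. Up to the
  choice of model, these are the interior vertices of the domain tree of a reduced tree pair diagram.\<close>

datatype cell = Node node | Tail nat

fun cell_map :: "cell \<Rightarrow> point \<Rightarrow> point" where
  "cell_map (Node v) p = (fst v, snd v @- snd p)"
| "cell_map (Tail J) p = (J + fst p, snd p)"

definition bad :: "(point \<Rightarrow> point) \<Rightarrow> cell set" where
  "bad f = {c. f \<circ> cell_map c \<notin> range cell_map}"

lemma shift_stream_cancel:
  assumes "\<And>z. u @- z = v @- (z :: bool stream)"
  shows "u = v"
  using assms
proof (induction u arbitrary: v)
  case Nil
  show ?case
  proof (cases v)
    case (Cons b w)
    have "shd (sconst (\<not> b)) = b" using Nil[of "sconst (\<not> b)"] Cons by (metis shift_simps(1) shift.simps list.sel(1) list.distinct(1) stream.sel(1))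
    then show ?thesis by simp
  qed simp
next
  case (Cons a u)
  show ?case
  proof (cases v)
    case Nil
    have "shd (sconst (\<not> a)) = a" using Cons.prems[of "sconst (\<not> a)"] Nil by (metis shift_simps(1) shift.simps list.sel(1) list.distinct(1) stream.sel(1))
    then show ?thesis by simp
  next
    case v: (Cons b w)
    show ?thesis using Cons.prems Cons.IH[of w] by (simp add: v)
  qed
qed

lemma inj_cell_map: "inj cell_map"
proof (rule injI)
  fix c d assume eq: "cell_map c = cell_map d"
  define z where "z = sconst True"
  have *: "cell_map c (k, z) = cell_map d (k, z)" for k z by (simp add: eq)
  show "c = d"
  proof (cases c; cases d)
    fix v w assume cd: "c = Node v" "d = Node w"
    have "snd v = snd w" by (rule shift_stream_cancel) (use * in \<open>simp add: cd\<close>)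
    then show ?thesis using * by (simp add: cd prod_eq_iff)
  next
    fix v J assume cd: "c = Node v" "d = Tail J"
    then show ?thesis using *[of 0 z] *[of 1 z] by simp
  next
    fix v J assume cd: "c = Tail J" "d = Node v"
    then show ?thesis using *[of 0 z] *[of 1 z] by simp
  next
    fix I J assume "c = Tail I" "d = Tail J"
    then show ?thesis using *[of 0 z] by simp
  qed
qed

lemma bad_id: "bad id = {}"
  by (simp add: bad_def)

text \<open>If \<open>f \<circ> s\<close> is bad on a cell on which \<open>s\<close> is good, then \<open>f\<close> is bad on the image of that cell. As \<open>s\<close>
  is injective, distinct cells have distinct images, so the number of bad cells is subadditive.\<close>

lemma bad_comp:
  assumes s: "inj s" and fin: "finite (bad f)" "finite (bad s)"
  shows "finite (bad (f \<circ> s)) \<and> card (bad (f \<circ> s)) \<le> card (bad f) + card (bad s)"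
proof -
  define m where "m c = (THE d. s \<circ> cell_map c = cell_map d)" for c
  have m: "s \<circ> cell_map c = cell_map (m c)" if "c \<notin> bad s" for c
  proof -
    from that obtain d where d: "s \<circ> cell_map c = cell_map d" by (auto simp: bad_def)
    then have "m c = d" unfolding m_def by (auto simp: inj_eq[OF inj_cell_map])
    with d show ?thesis by simp
  qed
  let ?B = "bad (f \<circ> s) - bad s"
  have "inj_on m ?B"
  proof (rule inj_onI)
    fix c d assume "c \<in> ?B" "d \<in> ?B" "m c = m d"
    then have "s \<circ> cell_map c = s \<circ> cell_map d" using m by auto
    then have "cell_map c = cell_map d" using s by (simp add: fun_eq_iff inj_eq)
    then show "c = d" using inj_cell_map by (simp add: inj_eq)
  qed
  moreover have sub: "m ` ?B \<subseteq> bad f"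
  proof
    fix d assume "d \<in> m ` ?B"
    then obtain c where c: "c \<in> ?B" "d = m c" by blast
    then have "f \<circ> cell_map d = (f \<circ> s) \<circ> cell_map c" using m[of c] by (simp add: comp_assoc)
    with c show "d \<in> bad f" by (simp add: bad_def)
  qed
  ultimately have "finite ?B" "card ?B \<le> card (bad f)"
    using fin(1) by (meson finite_subset finite_imageD, metis card_image card_mono)
  moreover have "bad (f \<circ> s) \<subseteq> ?B \<union> bad s" by blast
  ultimately show ?thesis
    using fin card_mono[of "?B \<union> bad s" "bad (f \<circ> s)"] card_Un_le[of ?B "bad s"]
    by (meson finite_UnI finite_subset le_trans add_le_mono le_refl)
qed

fun graft_node :: "nat \<Rightarrow> node \<Rightarrow> node" where
  "graft_node i (j, w) = (if j < i then (j, w) else if j = i then (i, False # w)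
     else if j = Suc i then (i, True # w) else (j - 1, w))"

lemma graft_cell_map: "graft i \<circ> cell_map (Node v) = cell_map (Node (graft_node i v))"
  by (cases v) (auto simp: fun_eq_iff graft_def)

lemma finite_bad_graft: "finite (bad (graft i))"
proof -
  have "c \<in> Tail ` {..Suc i}" if "c \<in> bad (graft i)" for c
  proof (cases c)
    case (Node v)
    then show ?thesis using that by (simp add: bad_def graft_cell_map)
  next
    case (Tail J)
    have "graft i \<circ> cell_map (Tail J) = cell_map (Tail (J - 1))" if "J > Suc i"
      using that by (auto simp: fun_eq_iff graft_def)
    with that Tail show ?thesis by (force simp: bad_def)
  qed
  then show ?thesis by (meson finite_imageI finite_atMost finite_subset subsetI)
qed

lemma finite_bad_prune: "finite (bad (prune i))"
proof -
  have "c \<in> insert (Node (i, [])) (Tail ` {..i})" if c: "c \<in> bad (prune i)" for c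
  proof (cases c)
    case (Node v)
    obtain j w where v: "v = (j, w)" by fastforce
    show ?thesis
    proof (cases "j = i")
      case True
      have "prune i \<circ> cell_map (Node (i, b # w')) = cell_map (Node (if b then Suc i else i, w'))" for b w'
        by (auto simp: fun_eq_iff prune_def)
      then show ?thesis using c unfolding Node v True by (cases w) (auto simp: bad_def)
    next
      case False
      then have "prune i \<circ> cell_map (Node v) = cell_map (Node (if j < i then j else Suc j, w))"
        by (auto simp: fun_eq_iff prune_def v)
      then show ?thesis using c unfolding Node by (auto simp: bad_def)
    qed
  next
    case (Tail J)
    have "prune i \<circ> cell_map (Tail J) = cell_map (Tail (Suc J))" if "J > i"
      using that by (auto simp: fun_eq_iff prune_def)
    with c Tail show ?thesis by (force simp: bad_def)
  qed
  then show ?thesis by (meson finite_imageI finite_atMost finite_insert finite_subset subsetI)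
qed

lemma finite_bad_act:
  assumes "g \<in> carrier thompson_F"
  shows "finite (bad (act g))"
proof -
  have "finite (bad (word_act u))" for u
  proof (induction u)
    case (Cons l u)
    have "inj (word_act u)" using inj_act[OF thompson_F_class_closed] by (simp add: act_class)
    moreover have "finite (bad (letter_act l))"
      by (simp add: letter_act_def finite_bad_graft finite_bad_prune)
    ultimately show ?case
      unfolding word_act_Cons using bad_comp Cons.IH by blast
  qed (simp only: word_act_Nil bad_id finite.emptyI)
  then show ?thesis using assms by (elim thompson_F_classE) (simp add: act_class)
qed

text \<open>The bad cells of an element control the denominator of a reduced fraction, those of its inverse the
  numerator; both are counted.\<close>

definition complexity :: "nat gword set \<Rightarrow> nat" where
  "complexity g = card (bad (act g)) + card (bad (act (inv\<^bsub>thompson_F\<^esub> g)))"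

lemma complexity_one: "complexity \<one>\<^bsub>thompson_F\<^esub> = 0"
  by (simp add: complexity_def act_one bad_id)

lemma complexity_mult_le:
  assumes g: "g \<in> carrier thompson_F" and h: "h \<in> carrier thompson_F"
  shows "complexity (g \<otimes>\<^bsub>thompson_F\<^esub> h) \<le> complexity g + complexity h"
proof -
  have *: "card (bad (act (a \<otimes>\<^bsub>thompson_F\<^esub> b))) \<le> card (bad (act a)) + card (bad (act b))"
    if "a \<in> carrier thompson_F" "b \<in> carrier thompson_F" for a b
    using bad_comp[OF inj_act finite_bad_act finite_bad_act] that by (simp add: act_mult)
  show ?thesis
    using *[OF g h] *[of "inv\<^bsub>thompson_F\<^esub> h" "inv\<^bsub>thompson_F\<^esub> g"] g h
    by (simp add: complexity_def F.inv_mult_group)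
qed

section \<open>The shift endomorphisms\<close>

definition F_shift :: "nat \<Rightarrow> nat gword set \<Rightarrow> nat gword set" where
  "F_shift m = presented_lift thompson_rels
     (\<lambda>u. pres_class thompson_rels (map (\<lambda>(k, b). (k + m, b)) u))"

lemma F_shift_class:
  "F_shift m (pres_class thompson_rels u) = pres_class thompson_rels (map (\<lambda>(k, b). (k + m, b)) u)"
  unfolding F_shift_def
proof (rule presented_lift_class)
  fix u v :: "nat gword" assume "pres_eq thompson_rels u v"
  then have "pres_eq thompson_rels (map (\<lambda>(k, b). (k + m, b)) u) (map (\<lambda>(k, b). (k + m, b)) v)"
  proof (induction rule: pres_eq.induct)
    case (pres_cancel u x b v)
    show ?case
      using pres_eq.pres_cancel[of thompson_rels "map (\<lambda>(k, b). (k + m, b)) u" "x + m" b] by simp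
  next
    case (pres_rel r s u v)
    then obtain i j where "i < j" "r = [(i, False), (j, True), (i, True)]" "s = [(Suc j, True)]"
      by (auto simp: thompson_rels_def)
    then have "(map (\<lambda>(k, b). (k + m, b)) r, map (\<lambda>(k, b). (k + m, b)) s) \<in> thompson_rels"
      by (simp add: thompson_rels_def)
    from pres_eq.pres_rel[OF this] show ?case by simp
  qed (blast intro: pres_refl pres_sym pres_trans)+
  then show "pres_class thompson_rels (map (\<lambda>(k, b). (k + m, b)) u) =
      pres_class thompson_rels (map (\<lambda>(k, b). (k + m, b)) v)"
    by (simp only: pres_class_eq_iff)
qed

lemma F_shift_x: "F_shift m (thompson_x k) = thompson_x (k + m)"
  by (simp add: thompson_x_def F_shift_class)

lemma F_shift_0: "g \<in> carrier thompson_F \<Longrightarrow> F_shift 0 g = g"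
  by (elim thompson_F_classE) (simp add: F_shift_class case_prod_eta)

lemma F_shift_hom: "F_shift m \<in> hom thompson_F thompson_F"
proof (rule homI)
  fix g assume "g \<in> carrier thompson_F"
  then show "F_shift m g \<in> carrier thompson_F"
    by (elim thompson_F_classE) (simp add: F_shift_class thompson_F_class_closed)
next
  fix g h assume "g \<in> carrier thompson_F" "h \<in> carrier thompson_F"
  then show "F_shift m (g \<otimes>\<^bsub>thompson_F\<^esub> h) = F_shift m g \<otimes>\<^bsub>thompson_F\<^esub> F_shift m h"
    by (elim thompson_F_classE) (simp add: F_shift_class thompson_F_mult_class)
qed

lemma F_shift_closed: "g \<in> carrier thompson_F \<Longrightarrow> F_shift m g \<in> carrier thompson_F"
  using F_shift_hom by (rule hom_in_carrier)

lemma thompson_x_comm: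
  assumes "i < j"
  shows "thompson_x j \<otimes>\<^bsub>thompson_F\<^esub> thompson_x i = thompson_x i \<otimes>\<^bsub>thompson_F\<^esub> thompson_x (Suc j)"
  unfolding thompson_x_conj[OF assms, symmetric]
  by (simp add: F.m_assoc[symmetric] thompson_x_closed)

text \<open>Conjugation by \<open>x\<^sub>m\<close> carries each generator beyond \<open>x\<^sub>m\<close> to the next one.\<close>

lemma thompson_x_in_subgroup:
  assumes K: "subgroup K thompson_F" and x: "thompson_x m \<in> K" "thompson_x (Suc m) \<in> K"
  shows "thompson_x (m + k) \<in> K"
proof (induction k)
  case (Suc k)
  show ?case
  proof (cases "k = 0")
    case False
    then show ?thesis
      using Suc.IH x K thompson_x_conj[of m "m + k"]
      by (metis add_Suc_right less_add_same_cancel1 neq0_conv subgroup.m_closed subgroup.m_inv_closed)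
  qed (use x in simp)
qed (use x in simp)

lemma F_shift_in_subgroup:
  assumes K: "subgroup K thompson_F" and x: "thompson_x m \<in> K" "thompson_x (Suc m) \<in> K"
    and g: "g \<in> carrier thompson_F"
  shows "F_shift m g \<in> K"
proof -
  have "pres_class thompson_rels (map (\<lambda>(k, b). (k + m, b)) u) \<in> K" for u
  proof (induction u)
    case Nil
    show ?case using subgroup.one_closed[OF K] by (simp add: thompson_F_one_class)
  next
    case (Cons l u)
    obtain k b where l: "l = (k, b)" by fastforce
    have "thompson_x (k + m) \<in> K" using thompson_x_in_subgroup[OF K x, of k] by (simp add: add.commute)
    moreover from this have "inv\<^bsub>thompson_F\<^esub> thompson_x (k + m) \<in> K"
      by (rule subgroup.m_inv_closed[OF K])
    ultimately have "pres_class thompson_rels [(k + m, b)] \<in> K"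
      unfolding inv_thompson_x by (cases b) (simp_all add: thompson_x_def)
    from subgroup.m_closed[OF K this Cons.IH] show ?case
      by (simp add: l thompson_F_mult_class)
  qed
  then show ?thesis using g by (elim thompson_F_classE) (simp add: F_shift_class)
qed

abbreviation F_gens :: "nat gword set set" where
  "F_gens \<equiv> {thompson_x 0, thompson_x 1}"

lemma finite_generating_set_F: "finite_generating_set thompson_F F_gens"
proof -
  have sub: "F_gens \<subseteq> carrier thompson_F" by (simp add: thompson_x_closed)
  have "g \<in> generate thompson_F F_gens" if "g \<in> carrier thompson_F" for g
    using F_shift_in_subgroup[OF F.generate_is_subgroup[OF sub], of 0 g] F_shift_0[OF that] that
    by (simp add: generate.incl)
  then show ?thesis
    using F.generate_incl[OF sub] sub by (auto simp: finite_generating_set_def)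
qed

section \<open>Positive words and fractions\<close>

definition pos :: "nat list \<Rightarrow> nat gword set" where
  "pos P = pres_class thompson_rels (map (\<lambda>i. (i, True)) P)"

lemma pos_closed: "pos P \<in> carrier thompson_F"
  unfolding pos_def by (rule thompson_F_class_closed)

lemma pos_Nil: "pos [] = \<one>\<^bsub>thompson_F\<^esub>"
  and pos_Cons: "pos (i # P) = thompson_x i \<otimes>\<^bsub>thompson_F\<^esub> pos P"
  and pos_append: "pos (P @ Q) = pos P \<otimes>\<^bsub>thompson_F\<^esub> pos Q"
  by (simp_all add: pos_def thompson_x_def thompson_F_mult_class thompson_F_one_class)

lemma pos_swap: "i < j \<Longrightarrow> pos (j # i # P) = pos (i # Suc j # P)"
  by (simp add: pos_Cons F.m_assoc[symmetric] thompson_x_comm thompson_x_closed pos_closed)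

text \<open>A letter can be moved to the right past a smaller one at the price of increasing it by one, which
  leaves the length unchanged. So insertion sort works, with an inserted letter that grows on its way.\<close>

lemma pos_sorted:
  "\<exists>P'. sorted P' \<and> length P' = length P \<and> pos P' = pos P"
proof (induction P)
  case (Cons k P)
  then obtain R where R: "sorted R" "length R = length P" "pos R = pos P" by blast
  \<comment> \<open>Each letter of the result is at least the inserted letter or some old letter: this keeps the
    head of the list in front.\<close>
  have insert: "\<exists>R'. sorted R' \<and> length R' = Suc (length R) \<and> pos R' = pos (k # R)
      \<and> (\<forall>i\<in>set R'. k \<le> i \<or> (\<exists>j\<in>set R. j \<le> i))" if "sorted R" for k R
    using that
  proof (induction R arbitrary: k)
    case Nil
    show ?case by (intro exI[of _ "[k]"]) simp
  next
    case (Cons j R)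
    show ?case
    proof (cases "k \<le> j")
      case True
      then show ?thesis using Cons.prems by (intro exI[of _ "k # j # R"]) auto
    next
      case False
      obtain R' where R': "sorted R'" "length R' = Suc (length R)" "pos R' = pos (Suc k # R)"
          "\<forall>i\<in>set R'. Suc k \<le> i \<or> (\<exists>j\<in>set R. j \<le> i)"
        using Cons.IH[of "Suc k"] Cons.prems by auto
      have "pos (j # R') = pos (k # j # R)"
        using False by (simp add: pos_Cons[of j R'] R'(3) pos_swap) (simp add: pos_Cons)
      moreover have "sorted (j # R')"
        using R'(1,4) Cons.prems False by fastforce
      ultimately show ?thesis
        using R' False by (intro exI[of _ "j # R'"]) auto
    qed
  qed
  show ?case using insert[OF R(1), of k] R by (auto simp: pos_Cons)
qed (rule exI[of _ "[]"], simp)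

abbreviation F_length :: "nat gword set \<Rightarrow> nat" where
  "F_length \<equiv> word_length thompson_F F_gens"

lemmas F_length_mult_le = F.word_length_mult_le'[OF finite_generating_set_F]
  and F_length_inv_le = F.word_length_inv_le'[OF finite_generating_set_F]

lemma thompson_x_conj_x0:
  "thompson_x (Suc k) = inv\<^bsub>thompson_F\<^esub> (thompson_x 0 [^]\<^bsub>thompson_F\<^esub> k) \<otimes>\<^bsub>thompson_F\<^esub>
     (thompson_x 1 \<otimes>\<^bsub>thompson_F\<^esub> thompson_x 0 [^]\<^bsub>thompson_F\<^esub> k)"
proof (induction k)
  case (Suc k)
  let ?y = "thompson_x 0" and ?p = "thompson_x 0 [^]\<^bsub>thompson_F\<^esub> k"
  have p: "?p \<in> carrier thompson_F" by (simp add: thompson_x_closed)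
  have "thompson_x (Suc (Suc k)) = inv\<^bsub>thompson_F\<^esub> ?y \<otimes>\<^bsub>thompson_F\<^esub> thompson_x (Suc k) \<otimes>\<^bsub>thompson_F\<^esub> ?y"
    by (simp add: thompson_x_conj)
  also have "\<dots> = (inv\<^bsub>thompson_F\<^esub> ?y \<otimes>\<^bsub>thompson_F\<^esub> inv\<^bsub>thompson_F\<^esub> ?p) \<otimes>\<^bsub>thompson_F\<^esub>
      (thompson_x 1 \<otimes>\<^bsub>thompson_F\<^esub> (?p \<otimes>\<^bsub>thompson_F\<^esub> ?y))"
    unfolding Suc.IH using p by (simp add: F.m_assoc thompson_x_closed)
  finally show ?case
    using p by (simp add: F.inv_mult_group thompson_x_closed)
qed (simp add: thompson_x_closed)

lemma F_length_pow: "F_length (thompson_x 0 [^]\<^bsub>thompson_F\<^esub> (k::nat)) \<le> k"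
proof -
  have "F_length (thompson_x 0 [^]\<^bsub>thompson_F\<^esub> k) \<le> k * F_length (thompson_x 0)"
    by (rule F.word_length_nat_pow_le[OF finite_generating_set_F thompson_x_closed])
  also have "\<dots> \<le> k * 1"
    by (intro mult_le_mono2 F.word_length_generator) (simp_all add: thompson_x_closed)
  finally show ?thesis by simp
qed

text \<open>Since \<open>x\<^sub>k\<^sub>+\<^sub>1 = x\<^sub>0\<^sup>-\<^sup>k x\<^sub>1 x\<^sub>0\<^sup>k\<close>, the powers of \<open>x\<^sub>0\<close> between consecutive letters of a sorted
  product telescope. The left factor \<open>x\<^sub>0\<^sup>d\<close> is what the preceding letter leaves behind. The exponent
  rises from \<open>d\<close> to at most \<open>M\<close> in total, and the power left at the end has length at most \<open>M\<close>.\<close>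

lemma F_length_pos_positive_letters:
  assumes "sorted P" "\<forall>i\<in>set P. d < i \<and> i \<le> M" "d \<le> M"
  shows "F_length (thompson_x 0 [^]\<^bsub>thompson_F\<^esub> d \<otimes>\<^bsub>thompson_F\<^esub> pos P) \<le> length P + (2 * M - d)"
  using assms
proof (induction P arbitrary: d)
  case Nil
  then show ?case using F_length_pow[of d] by (simp add: pos_Nil thompson_x_closed)
next
  case (Cons i P)
  define k where "k = i - 1"
  have k: "i = Suc k" "d \<le> k" "Suc k \<le> M" using Cons.prems by (auto simp: k_def)
  let ?z = "\<lambda>m::nat. thompson_x 0 [^]\<^bsub>thompson_F\<^esub> m"
  have c: "?z m \<in> carrier thompson_F" for m by (simp add: thompson_x_closed)
  note cl = c thompson_x_closed pos_closed
  have zk: "?z k = ?z (k - d) \<otimes>\<^bsub>thompson_F\<^esub> ?z d"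
    using k F.nat_pow_mult[OF thompson_x_closed, of 0 "k - d" d] by simp
  have "?z d \<otimes>\<^bsub>thompson_F\<^esub> inv\<^bsub>thompson_F\<^esub> ?z k = inv\<^bsub>thompson_F\<^esub> ?z (k - d)"
    unfolding zk by (simp add: F.inv_mult_group F.m_assoc[symmetric] cl)
  then have "?z d \<otimes>\<^bsub>thompson_F\<^esub> pos (i # P) = inv\<^bsub>thompson_F\<^esub> ?z (k - d) \<otimes>\<^bsub>thompson_F\<^esub>
      (thompson_x 1 \<otimes>\<^bsub>thompson_F\<^esub> (?z k \<otimes>\<^bsub>thompson_F\<^esub> pos P))"
    unfolding pos_Cons k(1) thompson_x_conj_x0[of k]
    by (metis (no_types, lifting) F.m_assoc F.inv_closed F.m_closed cl)
  then have "F_length (?z d \<otimes>\<^bsub>thompson_F\<^esub> pos (i # P)) \<le> F_length (inv\<^bsub>thompson_F\<^esub> ?z (k - d)) +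
      (F_length (thompson_x 1) + F_length (?z k \<otimes>\<^bsub>thompson_F\<^esub> pos P))"
    using F_length_mult_le cl F.inv_closed F.m_closed by (smt (verit) add_left_mono order_trans)
  moreover have "F_length (inv\<^bsub>thompson_F\<^esub> ?z (k - d)) \<le> k - d"
    using F_length_inv_le[OF c] F_length_pow order_trans by blast
  moreover have "F_length (thompson_x 1) \<le> 1"
    by (rule F.word_length_generator) (simp_all add: thompson_x_closed)
  moreover have "F_length (?z k \<otimes>\<^bsub>thompson_F\<^esub> pos P) \<le> length P + (2 * M - k)"
    by (rule Cons.IH) (use Cons.prems k in auto)
  ultimately show ?case using k by simp
qed

lemma F_length_pos:
  assumes "sorted P" "\<forall>i\<in>set P. i \<le> M"
  shows "F_length (pos P) \<le> length P + 2 * M"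
  using assms
proof (induction P)
  case (Cons i P)
  show ?case
  proof (cases "i = 0")
    case True
    have "F_length (pos (i # P)) \<le> F_length (thompson_x i) + F_length (pos P)"
      unfolding pos_Cons by (rule F_length_mult_le[OF thompson_x_closed pos_closed])
    moreover have "F_length (thompson_x i) \<le> 1"
      by (rule F.word_length_generator) (simp_all add: thompson_x_closed True)
    moreover have "F_length (pos P) \<le> length P + 2 * M" using Cons by simp
    ultimately show ?thesis by simp
  next
    case False
    then show ?thesis
      using F_length_pos_positive_letters[of "i # P" 0 M] Cons.prems by (force simp: pos_closed)
  qed
qed (simp add: pos_Nil F.word_length_one)

text \<open>A positive letter moves to the left through an inverse positive word: it is cancelled by its own
  inverse, and passes every other letter with one of the two indices raised by one.\<close>

lemma inv_pos_mult_x: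
  "\<exists>u Q'. inv\<^bsub>thompson_F\<^esub> pos Q \<otimes>\<^bsub>thompson_F\<^esub> thompson_x j = pos u \<otimes>\<^bsub>thompson_F\<^esub> inv\<^bsub>thompson_F\<^esub> pos Q'"
proof (induction Q arbitrary: j)
  case Nil
  show ?case by (intro exI[of _ "[j]"] exI[of _ "[]"]) (simp add: pos_Nil pos_Cons thompson_x_closed)
next
  case (Cons i Q)
  note cl = thompson_x_closed pos_closed
  have start: "inv\<^bsub>thompson_F\<^esub> pos (i # Q) \<otimes>\<^bsub>thompson_F\<^esub> thompson_x j =
      inv\<^bsub>thompson_F\<^esub> pos Q \<otimes>\<^bsub>thompson_F\<^esub> (inv\<^bsub>thompson_F\<^esub> thompson_x i \<otimes>\<^bsub>thompson_F\<^esub> thompson_x j)"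
    by (simp add: pos_Cons F.inv_mult_group F.m_assoc cl)
  show ?case
  proof (cases "i = j")
    case True
    then show ?thesis
      unfolding start by (intro exI[of _ "[]"] exI[of _ Q]) (simp add: cl pos_Nil)
  next
    case False
    define a b where "a = (if i < j then Suc j else j)" and "b = (if i < j then i else Suc i)"
    have "thompson_x j \<otimes>\<^bsub>thompson_F\<^esub> thompson_x b = thompson_x i \<otimes>\<^bsub>thompson_F\<^esub> thompson_x a"
      using False thompson_x_comm[of i j] thompson_x_comm[of j i] by (auto simp: a_def b_def)
    then have swap: "inv\<^bsub>thompson_F\<^esub> thompson_x i \<otimes>\<^bsub>thompson_F\<^esub> thompson_x j =
        thompson_x a \<otimes>\<^bsub>thompson_F\<^esub> inv\<^bsub>thompson_F\<^esub> thompson_x b"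
      by (metis F.inv_closed F.inv_solve_left F.inv_solve_right F.m_assoc F.m_closed thompson_x_closed)
    obtain u Q' where *: "inv\<^bsub>thompson_F\<^esub> pos Q \<otimes>\<^bsub>thompson_F\<^esub> thompson_x a =
        pos u \<otimes>\<^bsub>thompson_F\<^esub> inv\<^bsub>thompson_F\<^esub> pos Q'"
      using Cons.IH by blast
    have "inv\<^bsub>thompson_F\<^esub> pos (i # Q) \<otimes>\<^bsub>thompson_F\<^esub> thompson_x j =
        (inv\<^bsub>thompson_F\<^esub> pos Q \<otimes>\<^bsub>thompson_F\<^esub> thompson_x a) \<otimes>\<^bsub>thompson_F\<^esub> inv\<^bsub>thompson_F\<^esub> thompson_x b"
      unfolding start swap by (simp add: F.m_assoc cl)
    also have "\<dots> = pos u \<otimes>\<^bsub>thompson_F\<^esub> inv\<^bsub>thompson_F\<^esub> pos (b # Q')"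
      unfolding * by (simp add: pos_Cons F.inv_mult_group F.m_assoc cl)
    finally show ?thesis by blast
  qed
qed

lemma fraction_ex:
  assumes "g \<in> carrier thompson_F"
  shows "\<exists>P Q. g = pos P \<otimes>\<^bsub>thompson_F\<^esub> inv\<^bsub>thompson_F\<^esub> pos Q"
proof -
  note cl = thompson_x_closed pos_closed
  have "\<exists>P Q. pres_class thompson_rels u = pos P \<otimes>\<^bsub>thompson_F\<^esub> inv\<^bsub>thompson_F\<^esub> pos Q" for u
  proof (induction u rule: rev_induct)
    case Nil
    show ?case
      by (intro exI[of _ "[]"]) (simp add: pos_Nil thompson_F_one_class[symmetric])
  next
    case (snoc l u)
    obtain k b where l: "l = (k, b)" by fastforce
    obtain P Q where PQ: "pres_class thompson_rels u = pos P \<otimes>\<^bsub>thompson_F\<^esub> inv\<^bsub>thompson_F\<^esub> pos Q"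
      using snoc.IH by blast
    show ?case
    proof (cases b)
      case True
      obtain v Q' where "inv\<^bsub>thompson_F\<^esub> pos Q \<otimes>\<^bsub>thompson_F\<^esub> thompson_x k =
          pos v \<otimes>\<^bsub>thompson_F\<^esub> inv\<^bsub>thompson_F\<^esub> pos Q'"
        using inv_pos_mult_x by blast
      then have "pres_class thompson_rels (u @ [l]) = pos (P @ v) \<otimes>\<^bsub>thompson_F\<^esub> inv\<^bsub>thompson_F\<^esub> pos Q'"
        using True unfolding thompson_F_mult_class[symmetric] PQ l
        by (simp add: pos_append F.m_assoc cl thompson_x_def[symmetric])
      then show ?thesis by blast
    next
      case False
      have "pres_class thompson_rels (u @ [l]) = pos P \<otimes>\<^bsub>thompson_F\<^esub> inv\<^bsub>thompson_F\<^esub> pos (k # Q)"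
        using False unfolding thompson_F_mult_class[symmetric] PQ l
        by (simp add: pos_Cons F.inv_mult_group F.m_assoc cl inv_thompson_x[symmetric])
      then show ?thesis by blast
    qed
  qed
  then show ?thesis using assms by (elim thompson_F_classE) simp
qed

section \<open>Complexity bounds word length\<close>

text \<open>A positive word \<open>P\<close> is read as a forest. From left to right, each letter \<open>k\<close> adds a caret at the
  \<open>k\<close>-th leaf; equivalently, from right to left, it joins the trees \<open>k\<close> and \<open>k + 1\<close>, which is the order of
  the recursion. Then \<open>leaf P k\<close> is the node at which the \<open>k\<close>-th leaf sits, and \<open>carets P\<close> is the set of
  interior nodes.\<close>

definition leaf :: "nat list \<Rightarrow> nat \<Rightarrow> node" where
  "leaf P k = foldr graft_node P (k, [])"

primrec carets :: "nat list \<Rightarrow> node set" where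
  "carets [] = {}"
| "carets (i # P) = insert (i, []) (graft_node i ` carets P)"

lemma leaf_Nil: "leaf [] k = (k, [])" and leaf_Cons: "leaf (i # P) k = graft_node i (leaf P k)"
  by (simp_all add: leaf_def)

lemma act_pos_leaf: "act (pos P) \<circ> cell_map (Node (k, [])) = cell_map (Node (leaf P k))"
proof (induction P)
  case Nil
  show ?case unfolding pos_Nil act_one leaf_Nil by simp
next
  case (Cons i P)
  have "act (pos (i # P)) \<circ> cell_map (Node (k, [])) = graft i \<circ> (act (pos P) \<circ> cell_map (Node (k, [])))"
    by (simp only: pos_Cons act_mult[OF thompson_x_closed pos_closed] act_x comp_assoc)
  also have "\<dots> = cell_map (Node (leaf (i # P) k))"
    unfolding Cons.IH leaf_Cons by (rule graft_cell_map)
  finally show ?case .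
qed

fun extend :: "node \<Rightarrow> bool list \<Rightarrow> node" where
  "extend (j, w) v = (j, w @ v)"

lemma extend_extend: "extend (extend n u) v = extend n (u @ v)"
  by (cases n) simp

lemma graft_node_extend: "graft_node i (extend n v) = extend (graft_node i n) v"
  by (cases n) simp

lemma cell_map_extend: "cell_map (Node (extend n v)) (k, z) = cell_map (Node n) (k, v @- z)"
  by (cases n) simp

lemma inj_graft_node: "inj (graft_node i)"
proof (rule injI)
  fix m n assume "graft_node i m = graft_node i n"
  then show "m = n" by (cases m; cases n) (auto split: if_splits)
qed

lemma graft_node_root: "graft_node i n = (j, []) \<longleftrightarrow> j \<noteq> i \<and> n = (if j < i then j else Suc j, [])"
  by (cases n) (auto split: if_splits)

lemma finite_carets: "finite (carets P)" and card_carets: "card (carets P) = length P"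
proof (induction P)
  case (Cons i P)
  case 1
  show ?case using Cons by simp
  case 2
  have "(i, []) \<notin> graft_node i ` carets P"
    using graft_node_root[of i _ i] by (metis imageE)
  then show ?case
    using Cons by (simp add: card_image inj_on_subset[OF inj_graft_node])
qed simp_all

text \<open>If the trees \<open>i\<close> and \<open>i + 1\<close> of \<open>P\<close> are single leaves with numbers \<open>k\<close> and \<open>k + 1\<close>, then \<open>P\<close> never
  touches the caret that joins them, so the caret can as well be added at the very end, at the leaf \<open>k\<close>.\<close>

lemma cancel_root_caret:
  assumes "leaf P k = (i, [])" "leaf P (Suc k) = (Suc i, [])"
  shows "\<exists>P'. length P' = length P \<and> pos (i # P) = pos (P' @ [k])"
  using assms
proof (induction P arbitrary: i)
  case Nil
  then show ?case by (intro exI[of _ "[]"]) (simp add: leaf_Nil)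
next
  case (Cons m P)
  have m: "m \<noteq> i" "m \<noteq> Suc i" and leaf_k: "leaf P k = (if i < m then i else Suc i, [])"
    "leaf P (Suc k) = (if Suc i < m then Suc i else Suc (Suc i), [])"
    using Cons.prems unfolding leaf_Cons graft_node_root by auto
  define i' m' where "i' = (if i < m then i else Suc i)" and "m' = (if i < m then m - 1 else m)"
  have "leaf P k = (i', [])" "leaf P (Suc k) = (Suc i', [])"
    using leaf_k m by (auto simp: i'_def split: if_splits)
  then obtain P' where P': "length P' = length P" "pos (i' # P) = pos (P' @ [k])"
    using Cons.IH by blast
  have "pos (i # m # P) = pos (m' # i' # P)"
    using pos_swap[of i m' P] pos_swap[of m i P] m by (auto simp: i'_def m'_def)
  then have "pos (i # m # P) = pos ((m' # P') @ [k])"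
    unfolding pos_Cons[of m' "i' # P"] append_Cons pos_Cons[of m' "P' @ [k]"] by (simp only: P'(2))
  then show ?case using P'(1) by (intro exI[of _ "m' # P'"]) simp
qed

text \<open>An exposed caret of a forest, whose two children are the leaves \<open>k\<close> and \<open>k + 1\<close>, can be split off as
  the last letter.\<close>

lemma cancel_caret:
  assumes "leaf P k = extend n [False]" "leaf P (Suc k) = extend n [True]"
  shows "\<exists>P'. Suc (length P') = length P \<and> pos P = pos (P' @ [k])"
  using assms
proof (induction P arbitrary: n)
  case Nil
  then show ?case by (cases n) (simp add: leaf_Nil)
next
  case (Cons i P)
  obtain n0 n1 where n01: "leaf P k = n0" "leaf P (Suc k) = n1" by blast
  have *: "graft_node i n0 = extend n [False]" "graft_node i n1 = extend n [True]"
    using Cons.prems by (simp_all add: leaf_Cons n01)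
  show ?case
  proof (cases "n = (i, [])")
    case True
    then have "graft_node i n0 = graft_node i (i, [])" "graft_node i n1 = graft_node i (Suc i, [])"
      using * by simp_all
    then have "n0 = (i, [])" "n1 = (Suc i, [])"
      using inj_graft_node[of i] by (simp_all only: inj_eq)
    then show ?thesis using cancel_root_caret[of P k i] n01 by auto
  next
    case False
    have "\<exists>m. n = graft_node i m"
    proof -
      obtain j w where n: "n = (j, w)" by fastforce
      consider "j < i" | b w' where "j = i" "w = b # w'" | "j > i"
        using False n by (metis linorder_neqE_nat list.exhaust)
      then show ?thesis
      proof cases
        case 2
        then show ?thesis by (intro exI[of _ "(if b then Suc i else i, w')"]) (simp add: n)
      next
        case 1
        then show ?thesis by (intro exI[of _ "(j, w)"]) (simp add: n)
      next
        case 3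
        then show ?thesis by (intro exI[of _ "(Suc j, w)"]) (simp add: n)
      qed
    qed
    then obtain m where m: "n = graft_node i m" by blast
    have "n0 = extend m [False]" "n1 = extend m [True]"
      using * inj_graft_node[of i] unfolding m graft_node_extend[symmetric] by (simp_all only: inj_eq)
    then obtain P' where "Suc (length P') = length P" "pos P = pos (P' @ [k])"
      using Cons.IH n01 by blast
    then show ?thesis by (intro exI[of _ "i # P'"]) (simp add: pos_Cons)
  qed
qed

lemma consecutive_root_leaves:
  assumes "(i, []) \<notin> carets P" "(Suc i, []) \<notin> carets P"
  shows "\<exists>k. leaf P k = (i, []) \<and> leaf P (Suc k) = (Suc i, [])"
  using assms
proof (induction P arbitrary: i)
  case (Cons m P)
  define i' where "i' = (if i < m then i else Suc i)"
  have m: "m \<noteq> i" "m \<noteq> Suc i" using Cons.prems by auto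
  have eq: "graft_node m (i', []) = (i, [])" "graft_node m (Suc i', []) = (Suc i, [])"
    using m by (auto simp: i'_def)
  have "(i', []) \<notin> carets P" "(Suc i', []) \<notin> carets P"
    using Cons.prems eq by (metis image_eqI insertCI carets.simps(2))+
  then obtain k where "leaf P k = (i', [])" "leaf P (Suc k) = (Suc i', [])"
    using Cons.IH by blast
  then show ?case using eq by (intro exI[of _ k]) (simp only: leaf_Cons)
qed (simp add: leaf_Nil)

text \<open>Among the interior nodes below a given one, a lowest one has two leaves as children, and these are
  consecutive.\<close>

lemma exposed_caret_below:
  assumes "n \<in> carets P"
  shows "\<exists>k w. leaf P k = extend n (w @ [False]) \<and> leaf P (Suc k) = extend n (w @ [True])"
  using assms
proof (induction P arbitrary: n)
  case (Cons i P)
  have lift: "\<exists>k w. leaf (i # P) k = extend (graft_node i m) (w @ [False]) \<and>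
      leaf (i # P) (Suc k) = extend (graft_node i m) (w @ [True])" if "m \<in> carets P" for m
    using Cons.IH[OF that] by (metis leaf_Cons graft_node_extend)
  consider m where "m \<in> carets P" "n = graft_node i m"
    | b where "n = (i, [])" "(if b then Suc i else i, []) \<in> carets P"
    | "n = (i, [])" "(i, []) \<notin> carets P" "(Suc i, []) \<notin> carets P"
    using Cons.prems by (cases "(i, []) \<in> carets P"; cases "(Suc i, []) \<in> carets P")
      (auto split: if_splits)
  then show ?case
  proof cases
    case (1 m)
    then show ?thesis using lift by blast
  next
    case (2 b)
    have "graft_node i (if b then Suc i else i, []) = extend n [b]"
      by (simp add: 2(1))
    then show ?thesis using lift[OF 2(2)] by (metis append_Cons append_Nil extend_extend)
  next
    case 3
    then obtain k where "leaf P k = (i, [])" "leaf P (Suc k) = (Suc i, [])"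
      using consecutive_root_leaves by blast
    then show ?thesis using 3 by (intro exI[of _ k] exI[of _ "[]"]) (simp add: leaf_Cons)
  qed
qed simp

text \<open>A letter is the number of the leaf at which a caret is added. This number exceeds the index of
  the tree that contains the leaf by at most the number of carets present so far, and that tree is
  nontrivial in the end.\<close>

lemma letters_bound:
  assumes "\<And>j. (j, []) \<in> carets P \<Longrightarrow> j < J"
  shows "\<forall>i\<in>set P. i < J + length P"
  using assms
proof (induction P arbitrary: J)
  case (Cons i P)
  have i: "i < J" using Cons.prems by simp
  have "j < Suc J" if "(j, []) \<in> carets P" for j
  proof (cases "j \<le> Suc i")
    case False
    then have "graft_node i (j, []) = (j - 1, [])" by simp
    then have "(j - 1, []) \<in> carets (i # P)" using that by (metis image_eqI insertCI carets.simps(2))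
    then show ?thesis using Cons.prems by fastforce
  qed (use i in simp)
  then have "\<forall>k\<in>set P. k < Suc J + length P" by (rule Cons.IH)
  then show ?case using i by auto
qed simp

text \<open>A common last letter, up to equality in F, could be cancelled. The lengths are part of the
  definition because the cancellation has to make the fraction shorter.\<close>

definition reduced :: "nat list \<Rightarrow> nat list \<Rightarrow> bool" where
  "reduced P Q \<longleftrightarrow> (\<nexists>k P' Q'. Suc (length P') = length P \<and> Suc (length Q') = length Q \<and>
     pos P = pos (P' @ [k]) \<and> pos Q = pos (Q' @ [k]))"

text \<open>Suppose that the element \<open>g\<close> of F given by the fraction is good on the cone of an interior node of
  \<open>Q\<close>. Below this node lies an exposed caret of \<open>Q\<close>. As \<open>g\<close> carries the leaves of \<open>Q\<close> to
  those of \<open>P\<close> and preserves the branching inside the cone, \<open>P\<close> has an exposed caret at the same leaf, so that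
  the fraction can be shortened.\<close>

lemma reduced_carets_bad:
  assumes red: "reduced P Q"
    and n: "n \<in> carets Q"
  shows "Node n \<in> bad (act (pos P \<otimes>\<^bsub>thompson_F\<^esub> inv\<^bsub>thompson_F\<^esub> pos Q))"
proof (rule ccontr)
  define g where "g = pos P \<otimes>\<^bsub>thompson_F\<^esub> inv\<^bsub>thompson_F\<^esub> pos Q"
  assume "Node n \<notin> bad (act (pos P \<otimes>\<^bsub>thompson_F\<^esub> inv\<^bsub>thompson_F\<^esub> pos Q))"
  then obtain c where c: "act g \<circ> cell_map (Node n) = cell_map c"
    by (auto simp: bad_def g_def)
  obtain k w where kw: "leaf Q k = extend n (w @ [False])" "leaf Q (Suc k) = extend n (w @ [True])"
    using exposed_caret_below[OF n] by blast
  obtain m where m: "c = Node m"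
  proof (cases c)
    case (Tail J)
    define z where "z = sconst True"
    have "cell_map c (0, z) = cell_map c (1, z)"
      unfolding c[symmetric] by simp
    then show ?thesis using Tail by simp
  qed (use that in blast)
  have "g \<otimes>\<^bsub>thompson_F\<^esub> pos Q = pos P"
    by (simp add: g_def F.m_assoc pos_closed)
  then have gQ: "act g \<circ> act (pos Q) = act (pos P)"
    using act_mult[of g "pos Q"] by (simp add: g_def pos_closed)
  have leaf_P: "leaf P l = extend m v" if "leaf Q l = extend n v" for l v
  proof -
    have "cell_map (Node (leaf P l)) = act g \<circ> (act (pos Q) \<circ> cell_map (Node (l, [])))"
      unfolding act_pos_leaf[symmetric] gQ[symmetric] by (rule comp_assoc)
    also have "\<dots> = act g \<circ> cell_map (Node (extend n v))"
      by (simp only: act_pos_leaf that)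
    also have "\<dots> = cell_map (Node (extend m v))"
    proof
      fix p :: point
      show "(act g \<circ> cell_map (Node (extend n v))) p = cell_map (Node (extend m v)) p"
        using fun_cong[OF c, of "(fst p, v @- snd p)"] cell_map_extend[of _ v "fst p" "snd p"]
        by (simp add: m)
    qed
    finally show ?thesis using inj_cell_map by (simp add: inj_eq)
  qed
  obtain P' where "Suc (length P') = length P" "pos P = pos (P' @ [k])"
    using cancel_caret[of P k "extend m w"] leaf_P[OF kw(1)] leaf_P[OF kw(2)]
    by (auto simp: extend_extend)
  moreover obtain Q' where "Suc (length Q') = length Q" "pos Q = pos (Q' @ [k])"
    using cancel_caret[of Q k "extend n w"] kw by (auto simp: extend_extend)
  ultimately show False using red unfolding reduced_def by blast
qed

lemma bad_root_imp_bad_tails: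
  assumes "Node (i, []) \<in> bad f" "J \<le> i"
  shows "Tail J \<in> bad f"
proof (rule ccontr)
  assume "Tail J \<notin> bad f"
  then obtain c where c: "f \<circ> cell_map (Tail J) = cell_map c" by (auto simp: bad_def)
  define d where "d = (case c of Node m \<Rightarrow> Node m | Tail I \<Rightarrow> Node (I + (i - J), []))"
  have "(f \<circ> cell_map (Node (i, []))) p = cell_map d p" for p
    using fun_cong[OF c, of "(i - J, snd p)"] assms(2)
    by (auto simp: d_def split: cell.splits)
  then have "f \<circ> cell_map (Node (i, [])) = cell_map d" by blast
  then show False using assms(1) by (auto simp: bad_def)
qed

lemma reduced_denominator_bounds:
  assumes red: "reduced P Q"
    and N: "N = card (bad (act (pos P \<otimes>\<^bsub>thompson_F\<^esub> inv\<^bsub>thompson_F\<^esub> pos Q)))"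
  shows "length Q \<le> N" and "\<forall>i\<in>set Q. i < N + length Q"
proof -
  let ?B = "bad (act (pos P \<otimes>\<^bsub>thompson_F\<^esub> inv\<^bsub>thompson_F\<^esub> pos Q))"
  have fin: "finite ?B" by (intro finite_bad_act) (simp add: pos_closed)
  have sub: "Node ` carets Q \<subseteq> ?B" using reduced_carets_bad[OF red] by blast
  have "length Q = card (Node ` carets Q)"
    by (simp add: card_carets card_image inj_on_def)
  also have "\<dots> \<le> N" unfolding N by (rule card_mono[OF fin sub])
  finally show "length Q \<le> N" .
  show "\<forall>i\<in>set Q. i < N + length Q"
  proof (rule letters_bound)
    fix j assume "(j, []) \<in> carets Q"
    then have "Tail ` {..j} \<subseteq> ?B" using sub bad_root_imp_bad_tails by auto
    from card_mono[OF fin this] show "j < N" by (simp add: N card_image inj_on_def)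
  qed
qed

text \<open>Take a shortest fraction. It is reduced, so the lengths and the letters of both parts are bounded by
  the numbers of bad cells. After sorting, the word length of each part is bounded by its length and
  its letters. There is no additive constant, so elements of complexity zero are trivial; in particular the action is faithful.\<close>

lemma F_length_le_complexity:
  assumes g: "g \<in> carrier thompson_F"
  shows "F_length g \<le> 5 * complexity g"
proof -
  define frac where "frac P Q \<longleftrightarrow> g = pos P \<otimes>\<^bsub>thompson_F\<^esub> inv\<^bsub>thompson_F\<^esub> pos Q" for P Q
  define size where "size PQ = length (fst PQ) + length (snd PQ)" for PQ :: "nat list \<times> nat list"
  obtain P0 Q0 where "frac P0 Q0" using fraction_ex[OF g] by (auto simp: frac_def)
  then obtain PQ where "frac (fst PQ) (snd PQ)"
    and least: "\<And>PQ'. frac (fst PQ') (snd PQ') \<Longrightarrow> size PQ \<le> size PQ'"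
    using ex_has_least_nat[of "\<lambda>PQ. frac (fst PQ) (snd PQ)" "(P0, Q0)" size] by auto
  moreover obtain P where P: "sorted P" "length P = length (fst PQ)" "pos P = pos (fst PQ)"
    using pos_sorted by blast
  moreover obtain Q where Q: "sorted Q" "length Q = length (snd PQ)" "pos Q = pos (snd PQ)"
    using pos_sorted by blast
  ultimately have PQ: "g = pos P \<otimes>\<^bsub>thompson_F\<^esub> inv\<^bsub>thompson_F\<^esub> pos Q"
    by (simp add: frac_def)
  have min: "length P + length Q \<le> length P' + length Q'"
    if "g = pos P' \<otimes>\<^bsub>thompson_F\<^esub> inv\<^bsub>thompson_F\<^esub> pos Q'" for P' Q'
    using least[of "(P', Q')"] that P Q by (simp add: frac_def size_def)
  have False
    if len: "Suc (length P') = length P" "Suc (length Q') = length Q"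
      and eq: "pos P = pos (P' @ [k])" "pos Q = pos (Q' @ [k])" for k P' Q'
  proof -
    have "pos P \<otimes>\<^bsub>thompson_F\<^esub> inv\<^bsub>thompson_F\<^esub> pos Q = pos P' \<otimes>\<^bsub>thompson_F\<^esub>
        (pos [k] \<otimes>\<^bsub>thompson_F\<^esub> (inv\<^bsub>thompson_F\<^esub> pos [k] \<otimes>\<^bsub>thompson_F\<^esub> inv\<^bsub>thompson_F\<^esub> pos Q'))"
      unfolding eq pos_append by (simp add: F.inv_mult_group F.m_assoc pos_closed)
    also have "\<dots> = pos P' \<otimes>\<^bsub>thompson_F\<^esub> inv\<^bsub>thompson_F\<^esub> pos Q'"
      by (simp add: F.m_assoc[symmetric, of "pos [k]"] pos_closed)
    finally show False using min[of P' Q'] len PQ by simp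
  qed
  then have red: "reduced P Q" "reduced Q P" unfolding reduced_def by blast+
  define N N' where "N = card (bad (act g))" and "N' = card (bad (act (inv\<^bsub>thompson_F\<^esub> g)))"
  have inv_g: "inv\<^bsub>thompson_F\<^esub> g = pos Q \<otimes>\<^bsub>thompson_F\<^esub> inv\<^bsub>thompson_F\<^esub> pos P"
    unfolding PQ by (simp add: F.inv_mult_group pos_closed)
  have "length Q \<le> N" "\<forall>i\<in>set Q. i < N + length Q"
    using reduced_denominator_bounds[of P Q N] red(1) unfolding N_def PQ by blast+
  moreover from this have "F_length (pos Q) \<le> length Q + 2 * (N + length Q)"
    using F_length_pos[OF Q(1), of "N + length Q"] by force
  moreover have "length P \<le> N'" "\<forall>i\<in>set P. i < N' + length P"
    using reduced_denominator_bounds[of Q P N'] red(2) unfolding N'_def inv_g by blast+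
  moreover from this have "F_length (pos P) \<le> length P + 2 * (N' + length P)"
    using F_length_pos[OF P(1), of "N' + length P"] by force
  moreover have "F_length g \<le> F_length (pos P) + F_length (pos Q)"
    using F_length_mult_le[OF pos_closed F.inv_closed[OF pos_closed], of P Q] F_length_inv_le[OF pos_closed, of Q]
    unfolding PQ by linarith
  ultimately show ?thesis by (simp add: complexity_def N_def[symmetric] N'_def[symmetric])
qed

section \<open>Commuting cyclic factors\<close>

lemma (in group) inv_mult_swap:
  assumes "y \<otimes> b = b \<otimes> z" "y \<in> carrier G" "b \<in> carrier G" "z \<in> carrier G"
  shows "inv b \<otimes> y = z \<otimes> inv b"
proof -
  have "inv b \<otimes> y = inv b \<otimes> (y \<otimes> b) \<otimes> inv b" using assms(2-) by (simp add: m_assoc)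
  also have "\<dots> = z \<otimes> inv b" unfolding assms(1) using assms(2-) by (simp add: m_assoc[symmetric])
  finally show ?thesis .
qed

lemma (in group) subgroup_commuting:
  assumes c: "c \<in> carrier G"
  shows "subgroup {h \<in> carrier G. h \<otimes> c = c \<otimes> h} G"
proof (rule subgroupI)
  show "{h \<in> carrier G. h \<otimes> c = c \<otimes> h} \<noteq> {}" using c by (auto intro!: exI[of _ \<one>])
next
  fix a assume "a \<in> {h \<in> carrier G. h \<otimes> c = c \<otimes> h}"
  then show "inv a \<in> {h \<in> carrier G. h \<otimes> c = c \<otimes> h}"
    using c inv_mult_swap[of c a c] by simp
next
  fix a b assume "a \<in> {h \<in> carrier G. h \<otimes> c = c \<otimes> h}" "b \<in> {h \<in> carrier G. h \<otimes> c = c \<otimes> h}"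
  then have a: "a \<in> carrier G" "a \<otimes> c = c \<otimes> a" and b: "b \<in> carrier G" "b \<otimes> c = c \<otimes> b"
    by auto
  have "a \<otimes> b \<otimes> c = (a \<otimes> c) \<otimes> b" using a(1) b c by (simp add: m_assoc)
  also have "\<dots> = c \<otimes> (a \<otimes> b)" unfolding a(2) using a(1) b(1) c by (simp add: m_assoc)
  finally show "a \<otimes> b \<in> {h \<in> carrier G. h \<otimes> c = c \<otimes> h}" using a(1) b(1) by simp
qed auto

definition centralizer :: "nat gword set \<Rightarrow> nat gword set set" where
  "centralizer c = {h \<in> carrier thompson_F. h \<otimes>\<^bsub>thompson_F\<^esub> c = c \<otimes>\<^bsub>thompson_F\<^esub> h}"

lemma subgroup_centralizer:
  "c \<in> carrier thompson_F \<Longrightarrow> subgroup (centralizer c) thompson_F"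
  unfolding centralizer_def by (rule F.subgroup_commuting)

lemma centralizer_sym: "h \<in> centralizer c \<Longrightarrow> c \<in> carrier thompson_F \<Longrightarrow> c \<in> centralizer h"
  by (simp add: centralizer_def)

lemma centralizer_int_pow:
  assumes "h \<in> centralizer c" "c \<in> carrier thompson_F"
  shows "h [^]\<^bsub>thompson_F\<^esub> (k::int) \<in> centralizer c"
  using F.subgroup_int_pow_closed[OF subgroup_centralizer] assms by blast

text \<open>The generators of the cyclic factors. As a map, \<open>quot i\<close> is supported on the trees \<open>2 * i\<close> and
  \<open>2 * i + 1\<close>.\<close>

definition quot :: "nat \<Rightarrow> nat gword set" where
  "quot i = thompson_x (2 * i) \<otimes>\<^bsub>thompson_F\<^esub> inv\<^bsub>thompson_F\<^esub> thompson_x (2 * i + 1)"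

lemma quot_closed: "quot i \<in> carrier thompson_F"
  by (simp add: quot_def thompson_x_closed)

text \<open>Both \<open>x\<^sub>2\<^sub>i\<close> and \<open>x\<^sub>2\<^sub>i\<^sub>+\<^sub>1\<close> conjugate \<open>x\<^sub>k\<close> to \<open>x\<^sub>k\<^sub>+\<^sub>1\<close>, so the two effects cancel.\<close>

lemma x_centralizes_quot:
  assumes "2 * i + 2 \<le> k"
  shows "thompson_x k \<in> centralizer (quot i)"
proof -
  let ?a = "thompson_x (2 * i)" and ?b = "thompson_x (2 * i + 1)" and ?x = "thompson_x k"
    and ?x' = "thompson_x (Suc k)"
  note cl = thompson_x_closed
  have "?x \<otimes>\<^bsub>thompson_F\<^esub> ?b = ?b \<otimes>\<^bsub>thompson_F\<^esub> ?x'"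
    using assms by (intro thompson_x_comm) simp
  from F.inv_mult_swap[OF this cl cl cl]
  have b: "inv\<^bsub>thompson_F\<^esub> ?b \<otimes>\<^bsub>thompson_F\<^esub> ?x = ?x' \<otimes>\<^bsub>thompson_F\<^esub> inv\<^bsub>thompson_F\<^esub> ?b" .
  have a: "?x \<otimes>\<^bsub>thompson_F\<^esub> ?a = ?a \<otimes>\<^bsub>thompson_F\<^esub> ?x'"
    using assms by (intro thompson_x_comm) simp
  have "?x \<otimes>\<^bsub>thompson_F\<^esub> quot i = (?x \<otimes>\<^bsub>thompson_F\<^esub> ?a) \<otimes>\<^bsub>thompson_F\<^esub> inv\<^bsub>thompson_F\<^esub> ?b"
    unfolding quot_def by (simp only: F.m_assoc cl F.inv_closed)
  also have "\<dots> = ?a \<otimes>\<^bsub>thompson_F\<^esub> (inv\<^bsub>thompson_F\<^esub> ?b \<otimes>\<^bsub>thompson_F\<^esub> ?x)"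
    unfolding a b by (simp only: F.m_assoc cl F.inv_closed)
  also have "\<dots> = quot i \<otimes>\<^bsub>thompson_F\<^esub> ?x"
    unfolding quot_def by (simp only: F.m_assoc cl F.inv_closed)
  finally show ?thesis by (simp add: centralizer_def cl)
qed

lemma F_shift_one: "F_shift m \<one>\<^bsub>thompson_F\<^esub> = \<one>\<^bsub>thompson_F\<^esub>"
  by (rule hom_one[OF F_shift_hom F.is_group F.is_group])

lemma F_shift_centralizes_quot:
  assumes "i < n" "g \<in> carrier thompson_F"
  shows "F_shift (2 * n) g \<in> centralizer (quot i)"
  using assms by (intro F_shift_in_subgroup subgroup_centralizer quot_closed x_centralizes_quot) auto

text \<open>This makes the commutation of distinct elements \<open>quot i\<close> a case of \<open>F_shift_centralizes_quot\<close>.\<close>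

lemma quot_eq_shift: "quot i = F_shift (2 * i) (quot 0)"
proof -
  interpret sh: group_hom thompson_F thompson_F "F_shift (2 * i)"
    by (unfold_locales) (rule F_shift_hom)
  show ?thesis
    by (simp add: quot_def thompson_x_closed F_shift_x sh.hom_inv add.commute)
qed

primrec quot_prod :: "nat \<Rightarrow> (nat \<Rightarrow> int) \<Rightarrow> nat gword set" where
  "quot_prod 0 a = \<one>\<^bsub>thompson_F\<^esub>"
| "quot_prod (Suc n) a = quot_prod n a \<otimes>\<^bsub>thompson_F\<^esub> quot n [^]\<^bsub>thompson_F\<^esub> a n"

lemma quot_prod_in_subgroup:
  assumes K: "subgroup K thompson_F" and "\<And>i. i < n \<Longrightarrow> quot i [^]\<^bsub>thompson_F\<^esub> a i \<in> K"
  shows "quot_prod n a \<in> K"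
  using assms(2) by (induction n) (simp_all add: subgroup.one_closed[OF K] subgroup.m_closed[OF K])

lemma quot_prod_closed: "quot_prod n a \<in> carrier thompson_F"
  by (rule quot_prod_in_subgroup[OF F.subgroup_self]) (simp add: quot_closed)

lemma quot_prod_cong: "(\<And>i. i < n \<Longrightarrow> a i = b i) \<Longrightarrow> quot_prod n a = quot_prod n b"
  by (induction n) auto

lemma quot_prod_centralizes:
  assumes h: "h \<in> carrier thompson_F" and "\<And>i. i < n \<Longrightarrow> h \<in> centralizer (quot i)"
  shows "quot_prod n a \<in> centralizer h"
proof (rule quot_prod_in_subgroup[OF subgroup_centralizer[OF h]])
  fix i assume "i < n"
  then show "quot i [^]\<^bsub>thompson_F\<^esub> a i \<in> centralizer h"
    using assms(2) centralizer_sym centralizer_int_pow quot_closed h by blast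
qed

lemma quot_prod_add:
  "quot_prod n (\<lambda>i. a i + b i) = quot_prod n a \<otimes>\<^bsub>thompson_F\<^esub> quot_prod n b"
proof (induction n)
  case (Suc n)
  let ?q = "\<lambda>k::int. quot n [^]\<^bsub>thompson_F\<^esub> k"
  note cl = quot_prod_closed F.int_pow_closed[OF quot_closed, of n]
  have "quot n \<in> centralizer (quot i)" if "i < n" for i
    using F_shift_centralizes_quot[OF that quot_closed] by (simp add: quot_eq_shift[of n])
  then have "quot_prod n b \<in> centralizer (quot n)"
    by (intro quot_prod_centralizes quot_closed)
  then have "?q (a n) \<in> centralizer (quot_prod n b)"
    by (rule centralizer_int_pow[OF centralizer_sym[OF _ quot_closed] quot_prod_closed])
  then have swap: "?q (a n) \<otimes>\<^bsub>thompson_F\<^esub> quot_prod n b = quot_prod n b \<otimes>\<^bsub>thompson_F\<^esub> ?q (a n)"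
    by (simp add: centralizer_def)
  have "quot_prod (Suc n) a \<otimes>\<^bsub>thompson_F\<^esub> quot_prod (Suc n) b = quot_prod n a \<otimes>\<^bsub>thompson_F\<^esub>
      ((?q (a n) \<otimes>\<^bsub>thompson_F\<^esub> quot_prod n b) \<otimes>\<^bsub>thompson_F\<^esub> ?q (b n))"
    by (simp add: F.m_assoc cl)
  also have "\<dots> = quot_prod (Suc n) (\<lambda>i. a i + b i)"
    unfolding swap by (simp add: Suc.IH F.m_assoc cl F.int_pow_mult[OF quot_closed, symmetric])
  finally show ?case by simp
qed simp

lemma quot_prod_zero: "quot_prod n (\<lambda>i. 0) = \<one>\<^bsub>thompson_F\<^esub>"
  by (induction n) simp_all

lemma quot_prod_single:
  "quot_prod n (\<lambda>j. if j = i then 1 else 0) = (if i < n then quot i else \<one>\<^bsub>thompson_F\<^esub>)"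
proof (induction n)
  case (Suc n)
  then show ?case by (cases "i = n") (simp_all add: quot_closed less_Suc_eq)
qed simp

section \<open>The homomorphism from the direct product\<close>

definition prod_map :: "nat \<Rightarrow> nat gword set \<times> (nat \<Rightarrow> int) \<Rightarrow> nat gword set" where
  "prod_map n = (\<lambda>(g, a). F_shift (2 * n) g \<otimes>\<^bsub>thompson_F\<^esub> quot_prod n a)"

abbreviation (input) F_times_Z :: "nat \<Rightarrow> (nat gword set \<times> (nat \<Rightarrow> int)) monoid" where
  "F_times_Z n \<equiv> thompson_F \<times>\<times> product_group {..<n} (\<lambda>_. integer_group)"

lemma group_hom_prod_map: "group_hom (F_times_Z n) thompson_F (prod_map n)"
proof (intro group_hom.intro group_hom_axioms.intro homI)
  show "group (F_times_Z n)"
    by (intro DirProd_group F.is_group product_group) simp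
  show "group thompson_F" by (rule F.is_group)
next
  fix x assume "x \<in> carrier (F_times_Z n)"
  then show "prod_map n x \<in> carrier thompson_F"
    by (cases x) (simp add: prod_map_def F_shift_closed quot_prod_closed)
next
  fix x y assume "x \<in> carrier (F_times_Z n)" "y \<in> carrier (F_times_Z n)"
  moreover obtain g a h b where x: "x = (g, a)" and y: "y = (h, b)"
    by (cases x, cases y) blast
  ultimately have gh: "g \<in> carrier thompson_F" "h \<in> carrier thompson_F"
    by simp_all
  let ?s = "F_shift (2 * n)"
  note cl = quot_prod_closed F_shift_closed[OF gh(1)] F_shift_closed[OF gh(2)]
  have "quot_prod n a \<in> centralizer (?s h)"
    by (intro quot_prod_centralizes F_shift_centralizes_quot F_shift_closed gh)
  then have swap: "?s h \<otimes>\<^bsub>thompson_F\<^esub> quot_prod n a = quot_prod n a \<otimes>\<^bsub>thompson_F\<^esub> ?s h"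
    by (simp add: centralizer_def)
  have "quot_prod n (\<lambda>i\<in>{..<n}. a i + b i) = quot_prod n a \<otimes>\<^bsub>thompson_F\<^esub> quot_prod n b"
    unfolding quot_prod_add[symmetric] by (rule quot_prod_cong) simp
  then have "prod_map n (x \<otimes>\<^bsub>F_times_Z n\<^esub> y) =
      ?s g \<otimes>\<^bsub>thompson_F\<^esub> (?s h \<otimes>\<^bsub>thompson_F\<^esub> quot_prod n a) \<otimes>\<^bsub>thompson_F\<^esub> quot_prod n b"
    by (simp add: x y prod_map_def hom_mult[OF F_shift_hom gh] F.m_assoc cl)
  also have "\<dots> = prod_map n x \<otimes>\<^bsub>thompson_F\<^esub> prod_map n y"
    unfolding swap by (simp add: x y prod_map_def F.m_assoc cl)
  finally show "prod_map n (x \<otimes>\<^bsub>F_times_Z n\<^esub> y) = prod_map n x \<otimes>\<^bsub>thompson_F\<^esub> prod_map n y" .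
qed

definition FZ_gens :: "nat \<Rightarrow> nat gword set set" where
  "FZ_gens n = {thompson_x (2 * i) \<otimes>\<^bsub>thompson_F\<^esub> inv\<^bsub>thompson_F\<^esub> thompson_x (2 * i + 1) | i. i < n}
     \<union> {thompson_x (2 * n), thompson_x (2 * n + 1)}"

lemma FZ_gens_eq: "FZ_gens n = quot ` {..<n} \<union> {thompson_x (2 * n), thompson_x (2 * n + 1)}"
  by (auto simp: FZ_gens_def quot_def)

lemma FZ_gens_subset: "FZ_gens n \<subseteq> carrier thompson_F"
  by (auto simp: FZ_gens_eq quot_closed thompson_x_closed)

lemma quot_in_generate: "i < n \<Longrightarrow> quot i \<in> generate thompson_F (FZ_gens n)"
  by (rule generate.incl) (simp add: FZ_gens_eq)

lemma F_shift_in_generate: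
  assumes "g \<in> carrier thompson_F"
  shows "F_shift (2 * n) g \<in> generate thompson_F (FZ_gens n)"
proof (rule F_shift_in_subgroup[OF F.generate_is_subgroup[OF FZ_gens_subset] _ _ assms])
  show "thompson_x (2 * n) \<in> generate thompson_F (FZ_gens n)"
    "thompson_x (Suc (2 * n)) \<in> generate thompson_F (FZ_gens n)"
    by (rule generate.incl, simp add: FZ_gens_eq)+
qed

lemma prod_map_image: "prod_map n ` carrier (F_times_Z n) = generate thompson_F (FZ_gens n)"
proof
  let ?H = "generate thompson_F (FZ_gens n)"
  have H: "subgroup ?H thompson_F" by (rule F.generate_is_subgroup[OF FZ_gens_subset])
  show "prod_map n ` carrier (F_times_Z n) \<subseteq> ?H"
  proof
    fix h assume "h \<in> prod_map n ` carrier (F_times_Z n)"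
    then obtain x where x: "x \<in> carrier (F_times_Z n)" "h = prod_map n x" by blast
    obtain g a where "x = (g, a)" by fastforce
    with x have ga: "h = prod_map n (g, a)" "g \<in> carrier thompson_F" by simp_all
    have "quot_prod n a \<in> ?H"
      by (intro quot_prod_in_subgroup[OF H] F.subgroup_int_pow_closed[OF H] quot_in_generate)
    then show "h \<in> ?H"
      by (simp add: ga prod_map_def subgroup.m_closed[OF H] F_shift_in_generate)
  qed
  interpret group_hom "F_times_Z n" thompson_F "prod_map n" by (rule group_hom_prod_map)
  show "?H \<subseteq> prod_map n ` carrier (F_times_Z n)"
  proof (rule F.generate_subgroup_incl[OF _ img_is_subgroup], rule subsetI)
    fix s assume "s \<in> FZ_gens n"
    then consider i where "i < n" "s = quot i" | e where "s = thompson_x (e + 2 * n)"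
      unfolding FZ_gens_eq by (metis UnE add.commute add_0 imageE insertE lessThan_iff singletonD)
    then show "s \<in> prod_map n ` carrier (F_times_Z n)"
    proof cases
      case 1
      have "quot_prod n (\<lambda>j\<in>{..<n}. if j = i then 1 else 0) =
          quot_prod n (\<lambda>j. if j = i then 1 else 0)"
        by (rule quot_prod_cong) simp
      then have "s = prod_map n (\<one>\<^bsub>thompson_F\<^esub>, \<lambda>j\<in>{..<n}. if j = i then 1 else 0)"
        using 1 by (simp add: prod_map_def F_shift_one quot_prod_single quot_closed)
      then show ?thesis by (rule image_eqI) simp
    next
      case 2
      have "quot_prod n (\<lambda>j\<in>{..<n}. 0) = quot_prod n (\<lambda>j. 0)"
        by (rule quot_prod_cong) simp
      then have "s = prod_map n (thompson_x e, \<lambda>j\<in>{..<n}. 0)"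
        by (simp add: 2 prod_map_def quot_prod_zero F_shift_x thompson_x_closed)
      then show ?thesis by (rule image_eqI) (simp add: thompson_x_closed)
    qed
  qed
qed

lemma generate_FZ_gensE:
  assumes "h \<in> generate thompson_F (FZ_gens n)"
  obtains g a where "h = prod_map n (g, a)" "g \<in> carrier thompson_F" "a \<in> {..<n} \<rightarrow>\<^sub>E UNIV"
proof -
  obtain x where x: "x \<in> carrier (F_times_Z n)" "h = prod_map n x"
    using assms unfolding prod_map_image[symmetric] by blast
  obtain g a where "x = (g, a)" by fastforce
  with x show thesis using that[of g a] by simp
qed

section \<open>Complexity on the subgroup\<close>

definition up :: "nat \<Rightarrow> point \<Rightarrow> point" where
  "up m p = (fst p + m, snd p)"

lemma act_F_shift:
  assumes "g \<in> carrier thompson_F"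
  shows "act (F_shift m g) (up m p) = up m (act g p)"
    and "j < m \<Longrightarrow> act (F_shift m g) (j, z) = (j, z)"
proof -
  let ?s = "map (\<lambda>(k, b). (k + m, b))"
  have 1: "word_act (?s u) (up m p) = up m (word_act u p)" for u
  proof (induction u)
    case (Cons l u)
    have "letter_act (k + m, b) (up m q) = up m (letter_act (k, b) q)" for k b q
      by (cases q) (auto simp: letter_act_def graft_def prune_def up_def)
    then show ?case using Cons.IH by (cases l) (simp add: word_act_Cons)
  qed simp
  have 2: "word_act (?s u) (j, z) = (j, z)" if "j < m" for u
  proof (induction u)
    case (Cons l u)
    have "letter_act (k + m, b) (j, z) = (j, z)" for k b
      using that by (auto simp: letter_act_def graft_def prune_def)
    then show ?case using Cons.IH by (cases l) (simp add: word_act_Cons)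
  qed simp
  show "act (F_shift m g) (up m p) = up m (act g p)"
    using assms by (elim thompson_F_classE) (simp add: F_shift_class act_class 1)
  show "j < m \<Longrightarrow> act (F_shift m g) (j, z) = (j, z)"
    using assms by (elim thompson_F_classE) (simp add: F_shift_class act_class 2)
qed

lemma subgroup_stabilizer: "subgroup {g \<in> carrier thompson_F. act g p = p} thompson_F"
proof (rule F.subgroupI)
  show "{g \<in> carrier thompson_F. act g p = p} \<noteq> {}"
    using act_one by (metis (mono_tags, lifting) F.one_closed empty_iff id_apply mem_Collect_eq)
next
  fix a assume "a \<in> {g \<in> carrier thompson_F. act g p = p}"
  then show "inv\<^bsub>thompson_F\<^esub> a \<in> {g \<in> carrier thompson_F. act g p = p}"
    using act_inv_left[of a p] by simp
qed (simp_all add: act_mult subset_iff)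

lemma act_quot: "act (quot i) = graft (2 * i) \<circ> prune (2 * i + 1)"
  by (simp add: quot_def act_mult thompson_x_closed act_x act_inv_x)

lemma act_quot_pow_fix:
  assumes "j \<noteq> 2 * i" "j \<noteq> 2 * i + 1"
  shows "act (quot i [^]\<^bsub>thompson_F\<^esub> (k::int)) (j, z) = (j, z)"
proof -
  have "quot i \<in> {g \<in> carrier thompson_F. act g (j, z) = (j, z)}"
    using assms by (auto simp: quot_closed act_quot graft_def prune_def)
  from F.subgroup_int_pow_closed[OF subgroup_stabilizer this, of k] show ?thesis by simp
qed

text \<open>Each application of \<open>quot i\<close> pushes the tree \<open>2 * i\<close> one level down along its left spine.\<close>

lemma act_quot_pow: "act (quot i [^]\<^bsub>thompson_F\<^esub> (k::nat)) (2 * i, z) = (2 * i, replicate k False @- z)"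
proof (induction k arbitrary: z)
  case (Suc k)
  have "act (quot i) (2 * i, z) = (2 * i, False ## z)" for z
    by (simp add: act_quot graft_def prune_def)
  then have "act (quot i [^]\<^bsub>thompson_F\<^esub> Suc k) (2 * i, z) = (2 * i, replicate k False @- (False ## z))"
    using Suc.IH by (simp add: act_mult quot_closed)
  then show ?case
    using shift_append[of "replicate k False" "[False]" z] by (simp add: replicate_append_same)
qed (simp add: act_one)

lemma act_quot_prod:
  assumes "i < n" "a i = int k"
  shows "act (quot_prod n a) (2 * i, z) = (2 * i, replicate k False @- z)"
  using assms(1)
proof (induction n)
  case (Suc n)
  have act_Suc: "act (quot_prod (Suc n) a) p = act (quot_prod n a) (act (quot n [^]\<^bsub>thompson_F\<^esub> a n) p)" for p
    by (simp add: act_mult quot_prod_closed quot_closed)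
  show ?case
  proof (cases "i = n")
    case True
    have "quot_prod n a \<in> {g \<in> carrier thompson_F. act g (2 * n, w) = (2 * n, w)}" for w
    proof (rule quot_prod_in_subgroup[OF subgroup_stabilizer])
      fix l assume "l < n"
      then show "quot l [^]\<^bsub>thompson_F\<^esub> a l \<in> {g \<in> carrier thompson_F. act g (2 * n, w) = (2 * n, w)}"
        using act_quot_pow_fix[of "2 * n" l "a l" w] by (simp add: quot_closed)
    qed
    then show ?thesis
      using act_quot_pow[of n k z] assms(2) unfolding act_Suc by (simp add: True int_pow_int)
  next
    case False
    then have "act (quot n [^]\<^bsub>thompson_F\<^esub> a n) (2 * i, z) = (2 * i, z)"
      by (intro act_quot_pow_fix) presburger+
    then show ?thesis using Suc False unfolding act_Suc by simp
  qed
qed simp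

lemma act_quot_prod_fix: "act (quot_prod n a) (up (2 * n) p) = up (2 * n) p"
proof -
  have "quot_prod n a \<in> {g \<in> carrier thompson_F. act g (up (2 * n) p) = up (2 * n) p}"
    using act_quot_pow_fix by (intro quot_prod_in_subgroup[OF subgroup_stabilizer]) (simp add: up_def quot_closed)
  then show ?thesis by simp
qed

text \<open>Every bad cell of \<open>e\<close> has a shifted copy, and \<open>f\<close> is bad on it, since a cell whose points all lie in trees
  from the \<open>m\<close>-th on is itself a shifted copy.\<close>

lemma card_bad_le_of_up:
  assumes up: "\<And>p. f (up m p) = up m (e p)" and fin: "finite (bad f)"
  shows "card (bad e) \<le> card (bad f)"
proof -
  define u where "u c = (case c of Node v \<Rightarrow> Node (fst v + m, snd v) | Tail J \<Rightarrow> Tail (J + m))" for c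
  have u: "cell_map (u c) p = up m (cell_map c p)" for c p
    by (cases c) (simp_all add: u_def up_def)
  have inj_up: "up m p = up m q \<Longrightarrow> p = q" for p q
    by (simp add: up_def prod_eq_iff)
  have "inj u"
  proof (rule injI)
    fix c d assume "u c = u d"
    then have "cell_map c p = cell_map d p" for p using u inj_up by metis
    then show "c = d" using inj_cell_map by (metis ext inj_eq)
  qed
  moreover have "u ` bad e \<subseteq> bad f"
  proof (clarify, rule ccontr)
    fix c assume c: "c \<in> bad e" "u c \<notin> bad f"
    then obtain d where "f \<circ> cell_map (u c) = cell_map d" by (auto simp: bad_def)
    then have d: "up m (e (cell_map c p)) = cell_map d p" for p
      by (metis comp_apply u up)
    define z where "z = sconst True"
    have "m \<le> fst (cell_map d (0, z))" unfolding d[symmetric] by (simp add: up_def)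
    then have "d = u (case d of Node v \<Rightarrow> Node (fst v - m, snd v) | Tail J \<Rightarrow> Tail (J - m))"
      by (cases d) (simp_all add: u_def)
    then obtain d' where "d = u d'" by blast
    then have "e \<circ> cell_map c = cell_map d'"
      using d u inj_up by (metis comp_apply ext)
    then show False using c(1) by (auto simp: bad_def)
  qed
  ultimately show ?thesis
    using fin by (metis card_image card_mono inj_on_subset subset_UNIV)
qed

text \<open>If \<open>f\<close> were good on a cone of the left spine of the tree \<open>j\<close> at a depth less than \<open>k\<close>, then the whole tree \<open>j\<close>
  would be a proper subcone of its image.\<close>

lemma card_bad_ge_of_contraction:
  assumes f: "\<And>z. f (j, replicate k False @- z) = (j, z)" and fin: "finite (bad f)"
  shows "k \<le> card (bad f)"
proof -
  let ?c = "\<lambda>l. Node (j, replicate l False)"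
  have "?c l \<in> bad f" if "l < k" for l
  proof (rule ccontr)
    assume "?c l \<notin> bad f"
    then obtain c where c: "f \<circ> cell_map (?c l) = cell_map c" by (auto simp: bad_def)
    have split: "replicate l False @ replicate (k - l) False = replicate k False"
      using that by (simp add: replicate_add[symmetric])
    have *: "cell_map c (m, replicate (k - l) False @- z) = (j, z)" for m z
      unfolding c[symmetric] using f[of z] by (simp add: shift_append[symmetric] split)
    define z where "z = sconst True"
    show False
    proof (cases c)
      case (Tail J)
      then show False using *[of 0 z] *[of 1 z] by simp
    next
      case (Node v)
      have "snd v @ replicate (k - l) False = []"
        by (rule shift_stream_cancel) (use * Node in simp)
      then show False using that by simp
    qed
  qed
  then have "?c ` {..<k} \<subseteq> bad f" by blast
  moreover have "inj_on ?c {..<k}" by (rule inj_onI) (metis Pair_inject cell.inject(1) length_replicate)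
  ultimately show ?thesis using card_mono[OF fin] by (metis card_image card_lessThan)
qed

text \<open>The shifted copy of F acts on the trees from \<open>2 * n\<close> on, where the cyclic factors act trivially, so
  the bad cells of \<open>g\<close> reappear. A positive exponent of \<open>quot i\<close> produces bad cells of the inverse element on
  the tree \<open>2 * i\<close>; a negative one is treated by inverting the element.\<close>

lemma complexity_prod_map:
  assumes g: "g \<in> carrier thompson_F" and a: "a \<in> {..<n} \<rightarrow>\<^sub>E UNIV"
  shows "complexity g \<le> complexity (prod_map n (g, a))"
    and "i < n \<Longrightarrow> nat \<bar>a i\<bar> \<le> complexity (prod_map n (g, a))"
proof -
  interpret group_hom "F_times_Z n" thompson_F "prod_map n" by (rule group_hom_prod_map)
  have inv: "inv\<^bsub>thompson_F\<^esub> prod_map n (g, a) = prod_map n (inv\<^bsub>thompson_F\<^esub> g, \<lambda>i\<in>{..<n}. - a i)"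
    if "g \<in> carrier thompson_F" "a \<in> {..<n} \<rightarrow>\<^sub>E UNIV" for g a
    using hom_inv[of "(g, a)"] that
    by (simp add: inv_DirProd F.is_group)
  have closed: "prod_map n (g, a) \<in> carrier thompson_F" if "g \<in> carrier thompson_F" for g a
    using that by (simp add: prod_map_def F_shift_closed quot_prod_closed)
  note fin = finite_bad_act[OF closed]
  have act_pm: "act (prod_map n (g, a)) p = act (F_shift (2 * n) g) (act (quot_prod n a) p)"
    if "g \<in> carrier thompson_F" for g a p
    using that by (simp add: prod_map_def act_mult F_shift_closed quot_prod_closed)
  have 1: "card (bad (act g)) \<le> card (bad (act (prod_map n (g, a))))" if "g \<in> carrier thompson_F" for g a
    using that by (intro card_bad_le_of_up[where m = "2 * n"] fin)
      (simp_all add: act_pm act_quot_prod_fix act_F_shift)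
  show "complexity g \<le> complexity (prod_map n (g, a))"
    unfolding complexity_def inv[OF g a] by (intro add_mono 1 F.inv_closed g)
  have 2: "k \<le> card (bad (act (inv\<^bsub>thompson_F\<^esub> prod_map n (g, a))))"
    if "i < n" "a i = int k" "g \<in> carrier thompson_F" for g a i k
  proof (rule card_bad_ge_of_contraction[where j = "2 * i"])
    fix z
    have "act (prod_map n (g, a)) (2 * i, z) = (2 * i, replicate k False @- z)"
      using that by (simp add: act_pm act_quot_prod act_F_shift)
    then show "act (inv\<^bsub>thompson_F\<^esub> prod_map n (g, a)) (2 * i, replicate k False @- z) = (2 * i, z)"
      using act_inv_left[OF closed, of g a "(2 * i, z)"] that(3) by simp
  qed (intro finite_bad_act F.inv_closed closed that)
  show "nat \<bar>a i\<bar> \<le> complexity (prod_map n (g, a))" if i: "i < n"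
  proof (cases "a i" rule: int_cases2)
    case (nonneg k)
    then show ?thesis using 2[where i = i and a = a and k = k and g = g] i g nonneg by (simp add: complexity_def)
  next
    case (nonpos k)
    then have "(\<lambda>i\<in>{..<n}. - a i) i = int k" using i by simp
    from 2[where a = "\<lambda>i\<in>{..<n}. - a i", OF i this F.inv_closed[OF g]]
    have "k \<le> card (bad (act (inv\<^bsub>thompson_F\<^esub> (inv\<^bsub>thompson_F\<^esub> prod_map n (g, a)))))"
      unfolding inv[OF g a] .
    then show ?thesis using nonpos closed[OF g] by (simp add: complexity_def)
  qed
qed

section \<open>The subgroup is a product and is undistorted\<close>

text \<open>An element of the kernel is mapped to an element of complexity zero, hence has complexity zero
  itself and vanishing exponents.\<close>

lemma prod_map_iso:
  "prod_map n \<in> iso (F_times_Z n) (thompson_F\<lparr>carrier := generate thompson_F (FZ_gens n)\<rparr>)"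
proof -
  interpret group_hom "F_times_Z n" thompson_F "prod_map n" by (rule group_hom_prod_map)
  have "x = \<one>\<^bsub>F_times_Z n\<^esub>" if x: "x \<in> carrier (F_times_Z n)" "prod_map n x = \<one>\<^bsub>thompson_F\<^esub>" for x
  proof -
    obtain g a where ga: "x = (g, a)" "g \<in> carrier thompson_F" "a \<in> {..<n} \<rightarrow>\<^sub>E UNIV"
      using x(1) by (cases x) simp
    have 0: "complexity (prod_map n (g, a)) = 0"
      using x(2) by (simp add: ga(1) complexity_one)
    have "F_length g = 0"
      using F_length_le_complexity[OF ga(2)] complexity_prod_map(1)[OF ga(2,3)] 0 by simp
    then have "g = \<one>\<^bsub>thompson_F\<^esub>"
      using F.word_length_eq_0_iff[of F_gens g] finite_generating_set_F ga(2)
      by (simp add: finite_generating_set_def)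
    moreover have "a = (\<lambda>i\<in>{..<n}. 0)"
      using complexity_prod_map(2)[OF ga(2,3)] 0 ga(3) by (force simp: PiE_def extensional_def)
    ultimately show ?thesis by (simp add: ga(1))
  qed
  then have "inj_on (prod_map n) (carrier (F_times_Z n))"
    using inj_on_one_iff by blast
  then show ?thesis
    using homh prod_map_image[of n] by (auto simp: iso_def bij_betw_def hom_def)
qed

text \<open>The length of \<open>prod_map n (g, a)\<close> inside the subgroup is at most linear in the word length of \<open>g\<close>
  and in the absolute values of the exponents. Both are bounded linearly by the complexity of the image, and that is
  bounded linearly by the word length in F.\<close>

lemma sub_undistorted:
  assumes S: "finite_generating_set thompson_F S"
    and T: "finite_generating_set (thompson_F\<lparr>carrier := generate thompson_F (FZ_gens n)\<rparr>) T"
  shows "\<exists>K. \<forall>h\<in>generate thompson_F (FZ_gens n).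
    word_length (thompson_F\<lparr>carrier := generate thompson_F (FZ_gens n)\<rparr>) T h \<le> K * word_length thompson_F S h"
proof -
  let ?H = "generate thompson_F (FZ_gens n)"
  let ?G = "thompson_F\<lparr>carrier := ?H\<rparr>"
  let ?l = "word_length ?G T"
  have H: "subgroup ?H thompson_F" by (rule F.generate_is_subgroup[OF FZ_gens_subset])
  interpret H: group ?G using H subgroup.subgroup_is_group F.is_group by blast
  have lmult: "?l (g \<otimes>\<^bsub>thompson_F\<^esub> h) \<le> ?l g + ?l h" if "g \<in> ?H" "h \<in> ?H" for g h
    using H.word_length_mult_le'[OF T, of g h] that by simp
  note quot = quot_in_generate[of _ n] and shift = F_shift_in_generate[of _ n]
  have one: "?l \<one>\<^bsub>thompson_F\<^esub> = 0" using H.word_length_one[of T] by simp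
  obtain K1 where K1: "\<And>g. g \<in> carrier thompson_F \<Longrightarrow> ?l (F_shift (2 * n) g) \<le> K1 * F_length g"
  proof -
    have "\<exists>K. \<forall>g\<in>carrier thompson_F. ?l (F_shift (2 * n) g) \<le> K * F_length g"
    proof (rule F.subadditive_le_word_length[OF finite_generating_set_F])
      show "?l (F_shift (2 * n) \<one>\<^bsub>thompson_F\<^esub>) = 0"
        unfolding F_shift_one by (rule one)
    next
      fix g h assume gh: "g \<in> carrier thompson_F" "h \<in> carrier thompson_F"
      show "?l (F_shift (2 * n) (g \<otimes>\<^bsub>thompson_F\<^esub> h)) \<le> ?l (F_shift (2 * n) g) + ?l (F_shift (2 * n) h)"
        unfolding hom_mult[OF F_shift_hom gh] by (intro lmult shift gh)
    qed
    then show thesis using that by blast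
  qed
  obtain K2 where K2: "\<And>h. h \<in> carrier thompson_F \<Longrightarrow> complexity h \<le> K2 * word_length thompson_F S h"
    using F.subadditive_le_word_length[OF S, of complexity] complexity_one complexity_mult_le by blast
  define M where "M = (\<Sum>i<n. ?l (quot i))"
  have qp_le: "?l (quot_prod m a) \<le> (\<Sum>i<m. nat \<bar>a i\<bar> * ?l (quot i))" if "m \<le> n" for m a
    using that
  proof (induction m)
    case 0
    then show ?case by (simp add: one)
  next
    case (Suc m)
    have pow: "quot m [^]\<^bsub>?G\<^esub> a m = quot m [^]\<^bsub>thompson_F\<^esub> a m"
      using F.int_pow_consistent[OF H quot[of m]] Suc.prems by simp
    have "?l (quot_prod (Suc m) a) \<le> ?l (quot_prod m a) + ?l (quot m [^]\<^bsub>thompson_F\<^esub> a m)"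
      unfolding quot_prod.simps using Suc.prems
      by (intro lmult quot_prod_in_subgroup[OF H] F.subgroup_int_pow_closed[OF H] quot) auto
    also have "?l (quot m [^]\<^bsub>thompson_F\<^esub> a m) \<le> nat \<bar>a m\<bar> * ?l (quot m)"
      unfolding pow[symmetric] using Suc.prems quot[of m] by (intro H.word_length_int_pow_le[OF T]) simp
    finally show ?case using Suc by simp
  qed
  show ?thesis
  proof (intro exI ballI)
    fix h assume h: "h \<in> ?H"
    then obtain g a where ga: "h = prod_map n (g, a)" "g \<in> carrier thompson_F" "a \<in> {..<n} \<rightarrow>\<^sub>E UNIV"
      by (rule generate_FZ_gensE)
    have "?l h \<le> ?l (F_shift (2 * n) g) + ?l (quot_prod n a)"
      unfolding ga(1) prod_map_def prod.case
      by (intro lmult shift ga quot_prod_in_subgroup[OF H] F.subgroup_int_pow_closed[OF H] quot)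
    also have "?l (F_shift (2 * n) g) \<le> K1 * (5 * complexity h)"
      using K1[OF ga(2)] F_length_le_complexity[OF ga(2)] complexity_prod_map(1)[OF ga(2,3)]
      unfolding ga(1) by (meson le_trans mult_le_mono2)
    also have "?l (quot_prod n a) \<le> (\<Sum>i<n. complexity h * ?l (quot i))"
      using complexity_prod_map(2)[OF ga(2,3)]
      by (intro order_trans[OF qp_le] sum_mono mult_le_mono1) (simp_all add: ga(1))
    also have "\<dots> = M * complexity h"
      by (simp add: M_def sum_distrib_left mult.commute)
    also have "K1 * (5 * complexity h) + M * complexity h = (5 * K1 + M) * complexity h"
      by (simp add: algebra_simps)
    also have "\<dots> \<le> (5 * K1 + M) * (K2 * word_length thompson_F S h)"
      using h subgroup.subset[OF H] by (intro mult_le_mono2 K2) auto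
    finally show "?l h \<le> ((5 * K1 + M) * K2) * word_length thompson_F S h"
      by (simp add: mult.assoc)
  qed
qed

theorem corollary4:
  fixes n :: nat and H :: "nat gword set set"
  assumes "n \<ge> 1"
    and "H = generate thompson_F
           ({thompson_x (2 * i) \<otimes>\<^bsub>thompson_F\<^esub> inv\<^bsub>thompson_F\<^esub> thompson_x (2 * i + 1) | i. i < n}
            \<union> {thompson_x (2 * n), thompson_x (2 * n + 1)})"
  shows "thompson_F\<lparr>carrier := H\<rparr> \<cong> thompson_F \<times>\<times> product_group {..<n} (\<lambda>_. integer_group)
         \<and> quasi_isometrically_embedded H thompson_F"
proof
  have H: "H = generate thompson_F (FZ_gens n)" by (simp only: assms(2) FZ_gens_def)
  have sub: "subgroup H thompson_F" unfolding H by (rule F.generate_is_subgroup[OF FZ_gens_subset])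
  interpret group_hom "F_times_Z n" thompson_F "prod_map n" by (rule group_hom_prod_map)
  show "thompson_F\<lparr>carrier := H\<rparr> \<cong> F_times_Z n"
    unfolding H by (rule G.iso_sym[OF is_isoI[OF prod_map_iso]])
  have gensH: "FZ_gens n \<subseteq> H" unfolding H by (auto intro: generate.incl)
  have "finite_generating_set (thompson_F\<lparr>carrier := H\<rparr>) (FZ_gens n)"
    using F.generate_consistent[OF gensH sub] gensH
    by (simp add: finite_generating_set_def FZ_gens_eq H[unfolded FZ_gens_eq])
  then show "quasi_isometrically_embedded H thompson_F"
    using sub_undistorted[of _ n] unfolding H[symmetric]
    by (intro F.quasi_isometrically_embeddedI[OF sub finite_generating_set_F]) auto
qed

end
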